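(* Let $G$ be a finite simple planar graph with at least one vertex in which no triangle shares an edge with a cycle of length $4$. Then $\frac{|V(G)|}{\alpha(G)} \le 4 - \frac{1}{30}$, where $\alpha(G)$ is the independence number of $G$.
   Context: $\alpha(G)$ is the maximum size of an independent set of $G$; $|V(G)|/\alpha(G)$ is the independence ratio of $G$. *)

theory Defs
  imports "HOL-Analysis.Analysis"
begin

definition simple_graph :: "'a set \<Rightarrow> 'a set set \<Rightarrow> bool" where
  "simple_graph V E \<longleftrightarrow> (\<forall>e\<in>E. e \<subseteq> V \<and> card e = 2)"

definition independent_set :: "'a set \<Rightarrow> 'a set set \<Rightarrow> 'a set \<Rightarrow> bool" where
  "independent_set V E S \<longleftrightarrow> S \<subseteq> V \<and> (\<forall>u\<in>S. \<forall>v\<in>S. {u, v} \<notin> E)"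

(* The maximum is meaningful only for finite V; the empty set is always a candidate. *)
definition independence_number :: "'a set \<Rightarrow> 'a set set \<Rightarrow> nat" where
  "independence_number V E = Max {card S | S. independent_set V E S}"

definition cycle_edges :: "'a list \<Rightarrow> 'a set set" where
  "cycle_edges xs = {{xs ! i, xs ! (Suc i mod length xs)} | i. i < length xs}"

(* Cycles are subgraphs, not necessarily induced; the closing edge is implicit,
   so the length of the cycle is the length of the list. *)
definition is_cycle :: "'a set set \<Rightarrow> 'a list \<Rightarrow> bool" where
  "is_cycle E xs \<longleftrightarrow> 3 \<le> length xs \<and> distinct xs \<and> cycle_edges xs \<subseteq> E"

(* A drawing in the plane (identified with the complex numbers): vertices are distinct points,
   each edge is a simple arc joining its two ends, and the interior of an edge contains
   neither a vertex nor a point of another edge. *)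
definition plane_drawing ::
  "'a set \<Rightarrow> 'a set set \<Rightarrow> ('a \<Rightarrow> complex) \<Rightarrow> ('a set \<Rightarrow> real \<Rightarrow> complex) \<Rightarrow> bool" where
  "plane_drawing V E p \<gamma> \<longleftrightarrow>
     inj_on p V \<and>
     (\<forall>e\<in>E. arc (\<gamma> e) \<and> {pathstart (\<gamma> e), pathfinish (\<gamma> e)} = p ` e) \<and>
     (\<forall>e\<in>E. \<gamma> e ` {0<..<1} \<inter> p ` V = {}) \<and>
     (\<forall>e\<in>E. \<forall>f\<in>E. e \<noteq> f \<longrightarrow> \<gamma> e ` {0<..<1} \<inter> path_image (\<gamma> f) = {})"

definition planar :: "'a set \<Rightarrow> 'a set set \<Rightarrow> bool" where
  "planar V E \<longleftrightarrow> (\<exists>p \<gamma>. plane_drawing V E p \<gamma>)"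

end

theory Submission
  imports Defs
begin

text \<open>
  Two ingredients. First, Euler's formula: with three or more faces, two that share an edge cannot both be
  triangles, nor a triangle and a 4-cycle, so each edge accounts for at most
  \<open>1/3 + 1/5 = 8/15\<close> of a face, whence \<open>7 |E| \<le> 15 |V|\<close>. Faces are represented by sample points;
  the edges bordering a face are those whose removal merges it with another face, and Janiszewski's
  theorem together with the Jordan curve theorem shows that an edge borders at most two faces and
  that the edges bordering a face all lie on cycles of such edges.

  Second, every finite graph in which no triangle shares an edge with a 4-cycle, planar or not,
  satisfies \<open>53 |V| \<le> 125 \<alpha> + 10 |E| + 4 t\<close>, where \<open>t\<close> is the number of components that are
  triangles. This goes by induction, putting a vertex of minimum degree into the independent set and
  deleting its closed neighbourhood; only vertices of degree 3 sometimes require three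
  vertices to be selected at once. Triangle components are harmless in the end since they
  have independence ratio 3.
\<close>

subsection \<open>Plane drawings\<close>

text \<open>For \<open>t = 0\<close> the two bounds combine to 221 |V| \<le> 875 \<alpha>, and
  875/221 lies just below 119/30 = 4 - 1/30. Of Euler's formula only the half that bounds the number
  of faces from below is needed, so it suffices to exhibit many points in distinct faces. Since the
  graph need not be 2-connected, the boundary of a face need not be a cycle; counting only edges
  that separate the face from another one leaves bridges out, and what remains is a union of cycles.
  The obstacle in the second bound is that deleting a closed neighbourhood can split off triangle
  components, each of which misses the bound without \<open>t\<close> by 4. Every triangle created
  in this way has to be paid for by the edges that attached it to the deleted set. At minimum degree
  3 a single selected vertex may fail when its neighbours are cubic too: the slack is then 3 without
  a triangle at the vertex and -7 with one.\<close>

locale fin_graph =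
  fixes V :: "'a set" and E :: "'a set set"
  assumes simple: "simple_graph V E" and finite_V: "finite V"
begin

lemma finite_E: "finite E"
proof (rule finite_subset)
  show "E \<subseteq> Pow V" using simple by (auto simp: simple_graph_def)
qed (simp add: finite_V)

lemma edge_in_V: "{u, v} \<in> E \<Longrightarrow> u \<in> V \<and> v \<in> V"
  using simple by (auto simp: simple_graph_def)

lemma no_loop: "{v, v} \<notin> E"
proof
  assume "{v, v} \<in> E"
  then have "card {v, v} = 2" using simple unfolding simple_graph_def by blast
  then show False by simp
qed

lemma edge_neq: "{u, v} \<in> E \<Longrightarrow> u \<noteq> v"
  using no_loop by blast

lemma edgeE:
  assumes "e \<in> E"
  obtains u v where "e = {u, v}" "u \<noteq> v"
proof -
  have "card e = 2" using simple assms by (auto simp: simple_graph_def)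
  then show thesis using that unfolding card_2_iff by blast
qed

end

abbreviation linked :: "'a set set \<Rightarrow> 'a \<Rightarrow> 'a \<Rightarrow> bool" where
  "linked A \<equiv> (\<lambda>x y. {x, y} \<in> A)\<^sup>*\<^sup>*"

lemma linked_sym: "linked A u v \<Longrightarrow> linked A v u"
proof (induction rule: rtranclp_induct)
  case (step y z)
  then show ?case
    using converse_rtranclp_into_rtranclp[of "\<lambda>x y. {x, y} \<in> A" z y u] by (simp add: insert_commute)
qed simp

lemma linked_mono: "linked A u v \<Longrightarrow> A \<subseteq> B \<Longrightarrow> linked B u v"
  by (induction rule: rtranclp_induct) (auto intro: rtranclp.rtrancl_into_rtrancl)

locale plane_graph = fin_graph V E for V :: "'a set" and E :: "'a set set" +
  fixes p :: "'a \<Rightarrow> complex" and \<gamma> :: "'a set \<Rightarrow> real \<Rightarrow> complex"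
  assumes drawing: "plane_drawing V E p \<gamma>"
begin

text \<open>All of \<open>V\<close> is drawn whatever \<open>A\<close> is, so inserting an edge adds
  nothing but its arc, whose ends are already there.\<close>

definition drawn :: "'a set set \<Rightarrow> complex set" where
  "drawn A = p ` V \<union> (\<Union>e\<in>A. path_image (\<gamma> e))"

abbreviation same_face :: "'a set set \<Rightarrow> complex \<Rightarrow> complex \<Rightarrow> bool" where
  "same_face A \<equiv> connected_component (- drawn A)"

lemma drawn_insert: "drawn (insert e A) = drawn A \<union> path_image (\<gamma> e)"
  by (auto simp: drawn_def)

lemma drawn_mono: "A \<subseteq> B \<Longrightarrow> drawn A \<subseteq> drawn B"
  by (auto simp: drawn_def)

lemma same_face_antimono: "same_face B x y \<Longrightarrow> A \<subseteq> B \<Longrightarrow> same_face A x y"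
  by (meson Compl_anti_mono connected_component_of_subset drawn_mono)

lemma edge_ends:
  assumes e: "e \<in> E"
  obtains u v where "e = {u, v}" "u \<noteq> v" "u \<in> V" "v \<in> V"
    "pathstart (\<gamma> e) = p u" "pathfinish (\<gamma> e) = p v"
proof -
  obtain a b where ab: "e = {a, b}" "a \<noteq> b" "a \<in> V" "b \<in> V"
  proof -
    have "card e = 2" "e \<subseteq> V" using simple e by (auto simp: simple_graph_def)
    then show thesis using that unfolding card_2_iff by blast
  qed
  have "{pathstart (\<gamma> e), pathfinish (\<gamma> e)} = {p a, p b}"
    using drawing e ab(1) unfolding plane_drawing_def by auto
  then consider "pathstart (\<gamma> e) = p a" "pathfinish (\<gamma> e) = p b"
    | "pathstart (\<gamma> e) = p b" "pathfinish (\<gamma> e) = p a"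
    by (auto simp: doubleton_eq_iff)
  then show ?thesis
  proof cases
    case 1
    then show ?thesis using that ab by blast
  next
    case 2
    then show ?thesis using that[of b a] ab by (simp add: insert_commute)
  qed
qed

lemma arc_edge: "e \<in> E \<Longrightarrow> arc (\<gamma> e)"
  using drawing by (simp add: plane_drawing_def)

lemma inj_p: "inj_on p V"
  using drawing by (simp add: plane_drawing_def)

lemma image_edge:
  assumes "e \<in> E" shows "path_image (\<gamma> e) = \<gamma> e ` {0<..<1} \<union> p ` e"
proof -
  have "p ` e = {\<gamma> e 0, \<gamma> e 1}"
    using drawing assms unfolding plane_drawing_def pathstart_def pathfinish_def by metis
  moreover have "{0..1::real} = {0<..<1} \<union> {0, 1}"
    by auto
  ultimately show ?thesis
    by (simp add: path_image_def image_Un)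
qed

lemma edge_inner_disjoint:
  assumes "e \<in> E" "A \<subseteq> E" "e \<notin> A"
  shows "\<gamma> e ` {0<..<1} \<inter> drawn A = {}"
proof -
  have "\<gamma> e ` {0<..<1} \<inter> p ` V = {}" "\<And>f. f \<in> A \<Longrightarrow> \<gamma> e ` {0<..<1} \<inter> path_image (\<gamma> f) = {}"
    using drawing assms unfolding plane_drawing_def by (blast, metis subsetD)
  then show ?thesis
    unfolding drawn_def by blast
qed

lemma edge_inter_drawn:
  assumes "e \<in> E" "A \<subseteq> E" "e \<notin> A"
  shows "path_image (\<gamma> e) \<inter> drawn A = p ` e"
proof -
  have "p ` e \<subseteq> drawn A"
    using simple assms unfolding simple_graph_def drawn_def by blast
  then show ?thesis
    unfolding image_edge[OF assms(1)] Int_Un_distrib2 edge_inner_disjoint[OF assms] by (simp add: Int_absorb2)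
qed

lemma compact_drawn: "A \<subseteq> E \<Longrightarrow> compact (drawn A)"
proof -
  assume "A \<subseteq> E"
  then have "finite A" "\<And>e. e \<in> A \<Longrightarrow> compact (path_image (\<gamma> e))"
    using finite_E finite_subset by (blast, simp add: arc_edge compact_arc_image subset_iff)
  then show ?thesis
    unfolding drawn_def using finite_V
    by (intro compact_Un compact_UN) (simp_all add: finite_imp_compact)
qed

section \<open>Faces of a subdrawing and the effect of one more edge\<close>

lemma open_faces: "A \<subseteq> E \<Longrightarrow> open (- drawn A)"
  by (simp add: compact_drawn compact_imp_closed open_Compl)

lemma connected_edge_inner: "e \<in> E \<Longrightarrow> connected (\<gamma> e ` {0<..<1})"
proof (rule connected_continuous_image)
  assume "e \<in> E"
  then have "continuous_on {0..1} (\<gamma> e)"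
    using arc_imp_path[OF arc_edge] by (simp add: path_def)
  then show "continuous_on {0<..<1} (\<gamma> e)"
    by (rule continuous_on_subset) auto
qed simp

text \<open>If the old face of \<open>x\<close> missed \<open>z\<close>, it would miss the whole
  interior of \<open>e\<close>, which is connected and disjoint from the old drawing; the ends of
  \<open>e\<close> are drawn already. So the face would survive the insertion and still join
  \<open>x\<close> to \<open>y\<close>.\<close>

lemma separated_face_touches:
  assumes e: "e \<in> E" "A \<subseteq> E" "e \<notin> A" and z: "z \<in> \<gamma> e ` {0<..<1}"
    and xy: "same_face A x y" "\<not> same_face (insert e A) x y"
  shows "same_face A x z"
proof (rule ccontr)
  assume no: "\<not> same_face A x z"
  let ?F = "connected_component_set (- drawn A) x"
  have "w \<notin> ?F" if "w \<in> \<gamma> e ` {0<..<1}" for w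
  proof
    assume "w \<in> ?F"
    moreover have "same_face A w z"
      using edge_inner_disjoint[OF e] connected_edge_inner[OF e(1)] that z
      by (intro connected_componentI[of "\<gamma> e ` {0<..<1}"]) auto
    ultimately show False
      using no by (metis connected_component_trans mem_Collect_eq)
  qed
  moreover have "?F \<inter> p ` e = {}"
    using edge_inter_drawn[OF e] connected_component_subset[of "- drawn A" x] by blast
  ultimately have "?F \<subseteq> - drawn (insert e A)"
    using connected_component_subset[of "- drawn A" x] image_edge[OF e(1)] by (auto simp: drawn_insert)
  then have "same_face (insert e A) x y"
    using xy(1) connected_component_in[OF xy(1)]
    by (intro connected_componentI[of ?F]) auto
  then show False using xy(2) by simp
qed

lemma linked_path_component:
  assumes "A \<subseteq> E" "linked A u v" "u \<in> V"
  shows "path_component (drawn A) (p u) (p v)"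
  using assms(2)
proof (induction rule: rtranclp_induct)
  case base
  then show ?case using assms by (simp add: drawn_def path_component_refl)
next
  case (step w v)
  have e: "{w, v} \<in> E" using step assms by blast
  have sub: "path_image (\<gamma> {w, v}) \<subseteq> drawn A"
    using step by (auto simp: drawn_def)
  have "path_component (drawn A) (p w) (p v)"
    using path_connected_component[of "path_image (\<gamma> {w,v})"] path_connected_path_image[OF arc_imp_path[OF arc_edge[OF e]]]
      image_edge[OF e] path_component_of_subset[OF sub] by blast
  then show ?case using step path_component_trans by metis
qed

text \<open>The drawing of \<open>A\<close> falls apart into the compact sets \<open>K1\<close>, the
  component of \<open>u\<close>, and \<open>K2\<close>, everything else. The arc of \<open>e\<close>
  meets \<open>K1\<close> in one point, and \<open>K1\<close> with the arc meets \<open>K2\<close>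
  in one point. Single points are connected and an arc does not separate the plane, so Janiszewski's
  theorem applies twice.\<close>

lemma same_face_insert_bridge:
  assumes e: "e \<in> E" "A \<subseteq> E" "e \<notin> A" "e = {u, v}" and no: "\<not> linked A u v"
    and xy: "same_face A x y" "x \<notin> drawn (insert e A)" "y \<notin> drawn (insert e A)"
  shows "same_face (insert e A) x y"
proof -
  define U where "U = {w \<in> V. linked A u w}"
  define A1 where "A1 = {f \<in> A. f \<subseteq> U}"
  define K1 where "K1 = p ` U \<union> (\<Union>f\<in>A1. path_image (\<gamma> f))"
  define K2 where "K2 = p ` (V - U) \<union> (\<Union>f\<in>A - A1. path_image (\<gamma> f))"
  have uv: "u \<in> V" "v \<in> V" "u \<noteq> v"
  proof -
    have "{u, v} \<subseteq> V \<and> card {u, v} = 2"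
      using bspec[OF simple[unfolded simple_graph_def] e(1)] unfolding e(4) .
    then show "u \<in> V" "v \<in> V" "u \<noteq> v" by auto
  qed
  have out: "f \<inter> U = {}" if "f \<in> A - A1" for f
  proof (rule ccontr)
    assume "f \<inter> U \<noteq> {}"
    have "f \<in> E" using that e(2) by blast
    then obtain a b where ab: "f = {a, b}" "a \<in> V" "b \<in> V"
      by (rule edge_ends)
    have "linked A a b" "linked A b a"
      using ab that by (simp_all add: insert_commute r_into_rtranclp)
    then have "a \<in> U \<longleftrightarrow> b \<in> U"
      using ab unfolding U_def by (blast intro: rtranclp_trans)
    then have "f \<subseteq> U" using ab(1) \<open>f \<inter> U \<noteq> {}\<close>
      by blast
    then show False using that A1_def by blast
  qed
  have K: "drawn A = K1 \<union> K2"
  proof -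
    have "p ` V = p ` U \<union> p ` (V - U)" by (auto simp: U_def)
    moreover have "(\<Union>f\<in>A. path_image (\<gamma> f))
        = (\<Union>f\<in>A1. path_image (\<gamma> f)) \<union> (\<Union>f\<in>A - A1. path_image (\<gamma> f))"
      by (auto simp: A1_def)
    ultimately show ?thesis
      unfolding K1_def K2_def drawn_def by (simp only: Un_ac)
  qed
  have fin: "finite A" using finite_E e finite_subset by blast
  have "compact K1" "compact K2"
  proof -
    have "compact (path_image (\<gamma> f))" if "f \<in> A" for f
      using that e(2) by (intro compact_arc_image arc_edge) blast
    moreover have "finite A1" "finite (A - A1)" "finite U" "finite (V - U)"
      using fin finite_V by (auto simp: A1_def U_def)
    ultimately show "compact K1" "compact K2"
      unfolding K1_def K2_def by (intro compact_Un compact_UN; simp add: finite_imp_compact A1_def)+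
  qed
  have inner: "\<gamma> f ` {0<..<1} \<inter> p ` V = {}" if "f \<in> E" for f
    using that drawing unfolding plane_drawing_def by blast
  have inner2: "\<gamma> f ` {0<..<1} \<inter> path_image (\<gamma> g) = {}" if "f \<in> E" "g \<in> E" "f \<noteq> g" for f g
    using that drawing unfolding plane_drawing_def by blast
  have A1E: "f \<in> E" "p ` f \<subseteq> p ` U" if "f \<in> A1" for f
    using that e(2) by (auto simp: A1_def)
  have A2E: "f \<in> E" "p ` f \<subseteq> p ` (V - U)" if "f \<in> A - A1" for f
  proof -
    show "f \<in> E" using that e(2) by blast
    then have "f \<subseteq> V" using simple by (simp add: simple_graph_def)
    then show "p ` f \<subseteq> p ` (V - U)" using out[OF that] by (intro image_mono) blast
  qed
  have pU: "p ` U \<inter> p ` (V - U) = {}"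
    using inj_p unfolding U_def inj_on_def by blast
  have UV: "U \<subseteq> V" unfolding U_def by blast
  have a: "p ` (V - U) \<inter> path_image (\<gamma> f) = {}" if "f \<in> A1" for f
    using A1E[OF that] inner[of f] pU by (simp add: image_edge disjoint_iff) blast
  have b: "p ` U \<inter> path_image (\<gamma> f) = {}" if "f \<in> A - A1" for f
    using A2E[OF that] inner[of f] pU UV by (simp add: image_edge disjoint_iff) blast
  have c: "path_image (\<gamma> g) \<inter> path_image (\<gamma> f) = {}" if "g \<in> A1" "f \<in> A - A1" for f g
  proof -
    have "f \<noteq> g" using that by blast
    then have "\<gamma> g ` {0<..<1} \<inter> path_image (\<gamma> f) = {}"
      using A1E[OF that(1)] A2E[OF that(2)] by (intro inner2) auto
    moreover have "p ` g \<inter> path_image (\<gamma> f) = {}"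
      using b[OF that(2)] A1E[OF that(1)] by (auto simp: disjoint_iff subset_iff)
    ultimately show ?thesis
      using A1E(1)[OF that(1)] by (simp add: image_edge Int_Un_distrib2)
  qed
  have disj: "K1 \<inter> K2 = {}"
  proof -
    have "p ` U \<inter> (\<Union>f\<in>A - A1. path_image (\<gamma> f)) = {}" using b by blast
    moreover have "(\<Union>f\<in>A1. path_image (\<gamma> f)) \<inter> p ` (V - U) = {}" using a by blast
    moreover have "(\<Union>f\<in>A1. path_image (\<gamma> f)) \<inter> (\<Union>f\<in>A - A1. path_image (\<gamma> f)) = {}"
      using c by blast
    ultimately show ?thesis
      unfolding K1_def K2_def using pU by (simp only: Int_Un_distrib Int_Un_distrib2) simp
  qed
  have "u \<in> U" "v \<in> V - U" using uv no by (auto simp: U_def)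
  have pe: "path_image (\<gamma> e) \<inter> (K1 \<union> K2) = {p u, p v}"
    using edge_inter_drawn[OF e(1-3)] e(4) K by auto
  have "p u \<in> K1" "p v \<in> K2"
    using \<open>u \<in> U\<close> \<open>v \<in> V - U\<close> unfolding K1_def K2_def by blast+
  have i1: "K1 \<inter> path_image (\<gamma> e) = {p u}" and i2: "(K1 \<union> path_image (\<gamma> e)) \<inter> K2 = {p v}"
  proof -
    have "x = p u" if "x \<in> K1" "x \<in> path_image (\<gamma> e)" for x
      using that pe disj \<open>p v \<in> K2\<close> by (metis Int_iff UnCI empty_iff insert_iff)
    moreover have "x = p v" if "x \<in> K2" "x \<in> path_image (\<gamma> e)" for x
      using that pe disj \<open>p u \<in> K1\<close> by (metis Int_iff UnCI empty_iff insert_iff)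
    ultimately show "K1 \<inter> path_image (\<gamma> e) = {p u}" "(K1 \<union> path_image (\<gamma> e)) \<inter> K2 = {p v}"
      using pe disj \<open>p u \<in> K1\<close> \<open>p v \<in> K2\<close> by (auto simp: Int_Un_distrib2)
  qed
  have "same_face (insert e A) x y = connected_component (- (K1 \<union> path_image (\<gamma> e) \<union> K2)) x y"
    unfolding drawn_insert K by (simp only: Un_assoc Un_commute[of K2])
  also have "\<dots>"
  proof (rule Janiszewski)
    have "connected_component (- path_image (\<gamma> e)) x y"
      using connected_arc_complement[OF arc_edge[OF e(1)]] xy
      unfolding connected_iff_connected_component drawn_insert by simp
    moreover have "connected_component (- K1) x y"
      using xy(1) K by (auto elim: connected_component_of_subset)
    moreover have "connected (K1 \<inter> path_image (\<gamma> e))" "closed (path_image (\<gamma> e))"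
      using arc_edge[OF e(1)] unfolding i1 by (simp_all add: compact_arc_image compact_imp_closed)
    ultimately show "connected_component (- (K1 \<union> path_image (\<gamma> e))) x y"
      using Janiszewski[OF \<open>compact K1\<close>] by blast
    show "connected_component (- K2) x y"
      using xy(1) K by (auto elim: connected_component_of_subset)
    show "compact (K1 \<union> path_image (\<gamma> e))" "closed K2" "connected ((K1 \<union> path_image (\<gamma> e)) \<inter> K2)"
      using \<open>compact K1\<close> \<open>compact K2\<close> arc_edge[OF e(1)] unfolding i2
      by (simp_all add: compact_arc_image compact_imp_closed compact_Un)
  qed
  finally show ?thesis .
qed

text \<open>The arc of \<open>e\<close> and an arc between its ends inside \<open>drawn A\<close>
  form a simple closed curve \<open>C\<close>, with inside and outside \<open>I\<close> and
  \<open>J\<close>. As \<open>C\<close> meets the old drawing in a connected set, Janiszewski's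
  theorem shows that points of one face of \<open>A\<close> are separated by \<open>e\<close> only
  if they lie on different sides of \<open>C\<close>.\<close>

lemma edge_in_closed_curve:
  assumes e: "e \<in> E" "A \<subseteq> E" "e \<notin> A" "e = {u, v}" and "linked A u v"
  obtains C I J where "path_image (\<gamma> e) \<subseteq> C" "C \<subseteq> drawn (insert e A)"
    "connected I" "connected J" "I \<inter> J = {}" "I \<union> J = - C"
    "C \<subseteq> closure I" "C \<subseteq> closure J"
    "\<forall>x y. same_face A x y \<longrightarrow> x \<in> I \<and> y \<in> I \<or> x \<in> J \<and> y \<in> J \<longrightarrow> same_face (insert e A) x y"
    "\<forall>x\<in>I. \<forall>y\<in>J. \<not> same_face (insert e A) x y"
proof -
  note result = that
  have main: thesis if st: "e = {a, b}" "a \<in> V" "b \<in> V" "a \<noteq> b" "linked A a b"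
    "pathstart (\<gamma> e) = p a" "pathfinish (\<gamma> e) = p b" for a b
  proof -
    have "path_component (drawn A) (p b) (p a)"
      using linked_path_component[OF e(2) st(5) st(2)] path_component_sym by blast
    moreover have "p b \<noteq> p a"
      using inj_p st by (auto simp: inj_on_def)
    moreover obtain h where "path h" "path_image h \<subseteq> drawn A" "pathstart h = p b" "pathfinish h = p a"
      using calculation unfolding path_component_def by blast
    \<comment> \<open>A path in the drawing may run through a point twice; an arc extracted from it
      makes the closed curve simple.\<close>
    ultimately obtain g where g: "arc g" "path_image g \<subseteq> drawn A" "pathstart g = p b" "pathfinish g = p a"
      using path_contains_arc[of h "p b" "p a"] by (metis dual_order.trans)
    let ?c = "\<gamma> e +++ g"
    define C where "C = path_image ?c"
    have int: "path_image (\<gamma> e) \<inter> drawn A = {p a, p b}"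
      using edge_inter_drawn[OF e(1-3)] st by auto
    have "path_image (\<gamma> e) \<inter> path_image g \<subseteq> {p a, p b}"
      using int g(2) by blast
    then have "simple_path ?c"
      using simple_path_join_loop[OF arc_edge[OF e(1)] g(1)] unfolding g(3,4) st(6,7) by simp
    moreover have "pathfinish ?c = pathstart ?c"
      using g(4) st(6) by simp
    ultimately have loop: "simple_path ?c" "pathfinish ?c = pathstart ?c" by auto
    have C: "C = path_image (\<gamma> e) \<union> path_image g"
      unfolding C_def using g st by (simp add: path_image_join)
    have ST: "drawn A \<inter> C = path_image g"
    proof -
      have "{p a, p b} \<subseteq> path_image g"
        using pathstart_in_path_image[of g] pathfinish_in_path_image[of g] unfolding g(3,4) by simp
      then show ?thesis
        unfolding C Int_Un_distrib using int g(2) by (simp add: Int_commute Int_absorb1 Int_absorb2 insert_absorb)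
    qed
    have union: "drawn (insert e A) = drawn A \<union> C"
      using C g by (auto simp: drawn_insert)
    note J = Jordan_inside_outside[OF loop, folded C_def]
    have clC: "closed C"
      unfolding C_def using loop by (simp add: closed_simple_path_image)
    show thesis
    proof (rule result)
      show "path_image (\<gamma> e) \<subseteq> C" "C \<subseteq> drawn (insert e A)"
        using C union by auto
      show "connected (inside C)" "connected (outside C)" "inside C \<inter> outside C = {}"
        "inside C \<union> outside C = - C" "C \<subseteq> closure (inside C)" "C \<subseteq> closure (outside C)"
        using J by (auto simp: frontier_def)
      have "same_face (insert e A) x y"
        if "same_face A x y" "x \<in> inside C \<and> y \<in> inside C \<or> x \<in> outside C \<and> y \<in> outside C" for x y
        unfolding union
      proof (rule Janiszewski[OF compact_drawn[OF e(2)] clC])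
        show "connected (drawn A \<inter> C)"
          unfolding ST using g by (simp add: connected_arc_image)
        have "inside C \<subseteq> - C" "outside C \<subseteq> - C" using J by blast+
        then show "connected_component (- C) x y"
          using that(2) J by (meson connected_componentI)
      qed (use that in auto)
      then show "\<forall>x y. same_face A x y \<longrightarrow>
          x \<in> inside C \<and> y \<in> inside C \<or> x \<in> outside C \<and> y \<in> outside C \<longrightarrow> same_face (insert e A) x y"
        by blast
      have "\<not> same_face (insert e A) x y" if "x \<in> inside C" "y \<in> outside C" for x y
      proof
        assume "same_face (insert e A) x y"
        then have "connected_component (- C) x y"
          by (rule connected_component_of_subset) (use union in auto)
        then obtain W where "connected W" "W \<subseteq> - C" "x \<in> W" "y \<in> W"
          by (auto simp: connected_component_def)
        moreover have "inside C \<inter> outside C \<inter> W = {}" "W \<subseteq> inside C \<union> outside C"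
          using J \<open>W \<subseteq> - C\<close> by auto
        ultimately show False
          using J that connectedD[of W "inside C" "outside C"] by (auto simp: disjoint_iff)
      qed
      then show "\<forall>x\<in>inside C. \<forall>y\<in>outside C. \<not> same_face (insert e A) x y"
        by blast
    qed
  qed
  obtain a b where ab: "e = {a, b}" "a \<noteq> b" "a \<in> V" "b \<in> V"
    "pathstart (\<gamma> e) = p a" "pathfinish (\<gamma> e) = p b"
    using e(1) by (rule edge_ends)
  have "a = u \<and> b = v \<or> a = v \<and> b = u"
    using ab(1) e(4) by (auto simp: doubleton_eq_iff)
  then have "linked A a b"
    using assms(5) linked_sym[OF assms(5)] by blast
  with main ab show thesis by blast
qed

text \<open>Records how inserting \<open>e\<close> splits the faces of \<open>A\<close>, with the
  closed curve itself forgotten. That curve lies in the drawing, so only points off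
  \<open>drawn E\<close> are required to have a side.\<close>

definition sides :: "'a set \<Rightarrow> 'a set set \<Rightarrow> complex set \<Rightarrow> complex set \<Rightarrow> bool" where
  "sides e A I J \<longleftrightarrow> - drawn E \<subseteq> I \<union> J \<and>
    (\<forall>x y. same_face A x y \<longrightarrow> x \<in> I \<and> y \<in> I \<or> x \<in> J \<and> y \<in> J \<longrightarrow> same_face (insert e A) x y) \<and>
    (\<forall>x\<in>I. \<forall>y\<in>J. \<not> same_face (insert e A) x y)"

lemma sides_cover: "sides e A I J \<Longrightarrow> x \<notin> drawn E \<Longrightarrow> x \<in> I \<or> x \<in> J"
  by (auto simp: sides_def)

lemma sides_same:
  "sides e A I J \<Longrightarrow> same_face A x y \<Longrightarrow> x \<in> I \<and> y \<in> I \<or> x \<in> J \<and> y \<in> J \<Longrightarrow> same_face (insert e A) x y"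
  unfolding sides_def by blast

lemma sides_separate: "sides e A I J \<Longrightarrow> x \<in> I \<Longrightarrow> y \<in> J \<Longrightarrow> \<not> same_face (insert e A) x y"
  by (auto simp: sides_def)

text \<open>The middle of \<open>e\<close> is on the closed curve, hence in the closure of both
  sides, and a small ball around it meets no other edge. The points \<open>a\<close> and
  \<open>b\<close> come from that ball; they reach the middle of \<open>e\<close> even in
  \<open>E - {e}\<close>, hence also in the sparser drawing of \<open>A\<close>.\<close>

lemma edge_sides:
  assumes e: "e \<in> E" "A \<subseteq> E" "e \<notin> A" "e = {u, v}" and "linked A u v"
  obtains I J a b where "sides e A I J" "a \<in> I" "b \<in> J" "a \<notin> drawn E" "b \<notin> drawn E"
    "same_face (E - {e}) a (\<gamma> e (1/2))" "same_face (E - {e}) b (\<gamma> e (1/2))"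
proof -
  obtain C I J where C: "path_image (\<gamma> e) \<subseteq> C" "C \<subseteq> drawn (insert e A)"
    and "connected I" "connected J" and C': "I \<inter> J = {}" "I \<union> J = - C" "C \<subseteq> closure I" "C \<subseteq> closure J"
    and same: "\<forall>x y. same_face A x y \<longrightarrow> x \<in> I \<and> y \<in> I \<or> x \<in> J \<and> y \<in> J \<longrightarrow> same_face (insert e A) x y"
    and sep: "\<forall>x\<in>I. \<forall>y\<in>J. \<not> same_face (insert e A) x y"
    by (rule edge_in_closed_curve[OF assms])
  let ?z = "\<gamma> e (1/2)"
  have z: "?z \<in> \<gamma> e ` {0<..<1}" by auto
  have "?z \<notin> drawn (E - {e})"
    using edge_inner_disjoint[OF e(1), of "E - {e}"] z by blast
  then obtain r where r: "r > 0" "ball ?z r \<subseteq> - drawn (E - {e})"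
    using open_contains_ball[of "- drawn (E - {e})"] open_faces[of "E - {e}"] by auto
  have "?z \<in> closure I" "?z \<in> closure J"
    using z C C' image_edge[OF e(1)] by blast+
  then obtain a b where ab: "a \<in> I" "a \<in> ball ?z r" "b \<in> J" "b \<in> ball ?z r"
  proof -
    have "\<exists>w\<in>I. dist w ?z < r" "\<exists>w\<in>J. dist w ?z < r"
      using \<open>?z \<in> closure I\<close> \<open>?z \<in> closure J\<close> r(1) by (simp_all add: closure_approachable)
    then show thesis using that by (auto simp: dist_commute)
  qed
  have E: "drawn E = drawn (E - {e}) \<union> path_image (\<gamma> e)"
    using drawn_insert[of e "E - {e}"] e(1) by (simp add: insert_absorb)
  have D: "drawn (insert e A) \<subseteq> drawn E"
    using e by (intro drawn_mono) auto
  have conn: "same_face (E - {e}) w ?z" if "w \<in> ball ?z r" for w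
    using r that by (intro connected_componentI[of "ball ?z r"]) auto
  show thesis
  proof (rule that[OF _ ab(1,3)])
    have "- drawn E \<subseteq> I \<union> J"
      unfolding C'(2) using C(2) D by blast
    then show "sides e A I J"
      unfolding sides_def using same sep by blast
    have "a \<notin> C" "b \<notin> C"
      using ab C'(2) by auto
    then show "a \<notin> drawn E" "b \<notin> drawn E"
      using ab r C(1) unfolding E by auto
  qed (use conn ab in auto)
qed

lemma same_face_sym: "same_face A x y \<Longrightarrow> same_face A y x"
  by (rule connected_component_sym)

lemma same_face_trans: "same_face A x y \<Longrightarrow> same_face A y z \<Longrightarrow> same_face A x z"
  by (rule connected_component_trans)

text \<open>
  One half of Euler's formula: a new edge either joins two classes of the partition \<open>P\<close> into
  connected vertex sets, or it closes a cycle and one of its two sides carries no sample point yet.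
  The sample points avoid the whole drawing so that they survive the addition of edges.
\<close>

lemma many_separated_points:
  assumes "A \<subseteq> E"
  shows "\<exists>X P. finite X \<and> X \<inter> drawn E = {} \<and> (\<forall>x\<in>X. \<forall>y\<in>X. same_face A x y \<longrightarrow> x = y) \<and>
    finite P \<and> \<Union>P = V \<and> (\<forall>C\<in>P. \<forall>u\<in>C. \<forall>v\<in>C. linked A u v) \<and>
    card A + card P + 1 \<le> card V + card X"
proof -
  have "finite A" using assms finite_E finite_subset by blast
  then show ?thesis using assms
  proof (induction A rule: finite_induct)
    case empty
    have "drawn E \<noteq> UNIV"
      using compact_drawn[of E] compact_imp_bounded not_bounded_UNIV by force
    then obtain x where "x \<notin> drawn E" by blast
    \<comment> \<open>One sample point and \<open>card V\<close> singleton classes: both sides of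
      the count equal \<open>card V + 1\<close>.\<close>
    then show ?case
      using finite_V by (intro exI[of _ "{x}"] exI[of _ "(\<lambda>v. {v}) ` V"]) (auto simp: card_image)
  next
    case (insert e A)
    then have e: "e \<in> E" "A \<subseteq> E" "e \<notin> A" by auto
    obtain X P where X: "finite X" "X \<inter> drawn E = {}" "\<And>x y. x \<in> X \<Longrightarrow> y \<in> X \<Longrightarrow> same_face A x y \<Longrightarrow> x = y"
      and P: "finite P" "\<Union>P = V" "\<And>C u v. C \<in> P \<Longrightarrow> u \<in> C \<Longrightarrow> v \<in> C \<Longrightarrow> linked A u v"
      and card: "card A + card P + 1 \<le> card V + card X"
      using insert.IH[OF e(2)] by metis
    obtain u v where uv: "e = {u, v}" "u \<noteq> v" "u \<in> V" "v \<in> V"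
      using e(1) by (rule edge_ends)
    then obtain C D where CD: "C \<in> P" "u \<in> C" "D \<in> P" "v \<in> D"
      using P(2) by blast
    have sub: "A \<subseteq> insert e A" by blast
    have X': "x = y" if "x \<in> X" "y \<in> X" "same_face (insert e A) x y" for x y
      using X(3)[OF that(1,2)] same_face_antimono[OF that(3) sub] by blast
    have P': "linked (insert e A) u v" if "C \<in> P" "u \<in> C" "v \<in> C" for C u v
      using linked_mono[OF P(3)[OF that] sub] .
    show ?case
    proof (cases "C = D")
      case False
      let ?P = "insert (C \<union> D) (P - {C, D})"
      have lk: "linked (insert e A) u v"
        using uv by (intro r_into_rtranclp) simp
      have 1: "linked (insert e A) x y" if "x \<in> C" "y \<in> D" for x y
        using P'[OF CD(1) that(1) CD(2)] lk P'[OF CD(3,4) that(2)] by (meson rtranclp_trans)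
      then have "linked (insert e A) x y" if "x \<in> C \<union> D" "y \<in> C \<union> D" for x y
        using that P'[OF CD(1)] P'[OF CD(3)] 1 linked_sym[of "insert e A"] by (meson Un_iff)
      then have "\<forall>C\<in>?P. \<forall>u\<in>C. \<forall>v\<in>C. linked (insert e A) u v"
        using P' by blast
      moreover have "card ?P + 1 \<le> card P"
      proof -
        have "card {C, D} \<le> card P"
          using P(1) CD by (intro card_mono) auto
        moreover have "card (P - {C, D}) = card P - card {C, D}"
          using CD by (intro card_Diff_subset) auto
        ultimately show ?thesis
          using card_insert_le_m1[of "card P - 1" "P - {C, D}" "C \<union> D"] False by auto
      qed
      moreover have "\<Union>?P = V" using CD P(2) by blast
      ultimately show ?thesis
        using X(1,2) X' P(1) card insert.hyps
        by (intro exI[of _ X] exI[of _ ?P]) auto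
    next
      case True
      then have "linked A u v" using P(3) CD by blast
      then obtain I J a b where sd: "sides e A I J"
        and ab: "a \<in> I" "b \<in> J" "a \<notin> drawn E" "b \<notin> drawn E"
          "same_face (E - {e}) a (\<gamma> e (1/2))" "same_face (E - {e}) b (\<gamma> e (1/2))"
        by (rule edge_sides[OF e uv(1)])
      note sep = sides_separate[OF sd]
      let ?z = "\<gamma> e (1/2)"
      have "A \<subseteq> E - {e}" using e by blast
      then have az: "same_face A a ?z" "same_face A b ?z"
        using same_face_antimono[OF ab(5)] same_face_antimono[OF ab(6)] by blast+
      have "\<exists>y. y \<notin> drawn E \<and> (\<forall>x\<in>X. \<not> same_face (insert e A) x y)"
      proof (cases "\<exists>x\<in>X. same_face A x ?z")
        case False
        then have "\<not> same_face (insert e A) x a" if "x \<in> X" for x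
          using same_face_antimono[OF _ sub, of x a] same_face_trans[OF _ az(1), of x] that by blast
        then show ?thesis using ab(3) by blast
      next
        case True
        then obtain x0 where x0: "x0 \<in> X" "same_face A x0 ?z" by blast
        \<comment> \<open>A sample point that shares a new face with \<open>w\<close> already lay in
          the old face around the middle of \<open>e\<close>, and \<open>x0\<close> is the only
          sample point there.\<close>
        have other: "x = x0" if "x \<in> X" "same_face (insert e A) x w" "same_face A w ?z" for x w
          using same_face_antimono[OF that(2) sub] that(1,3) x0 X(3)[of x x0]
            same_face_trans[of A x w ?z] same_face_trans[of A x ?z x0] same_face_sym[of A x0 ?z] by blast
        have "x0 \<in> I \<or> x0 \<in> J" using sides_cover[OF sd] x0 X(2) by blast
        then show ?thesis
        proof
          assume "x0 \<in> I"
          then have "\<not> same_face (insert e A) x b" if "x \<in> X" for x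
            using sep[of x0 b] ab(2) other[OF that _ az(2)] by blast
          then show ?thesis using ab(4) by blast
        next
          assume "x0 \<in> J"
          then have "\<not> same_face (insert e A) x a" if "x \<in> X" for x
            using sep[of a x0] ab(1) other[OF that _ az(1)] same_face_sym[of "insert e A" x a] by blast
          then show ?thesis using ab(3) by blast
        qed
      qed
      then obtain y where y: "y \<notin> drawn E" "\<And>x. x \<in> X \<Longrightarrow> \<not> same_face (insert e A) x y"
        by blast
      have "drawn (insert e A) \<subseteq> drawn E"
        using e by (intro drawn_mono) auto
      then have "y \<notin> X"
        using y connected_component_refl[of y "- drawn (insert e A)"] by blast
      have "\<forall>x\<in>insert y X. \<forall>z\<in>insert y X. same_face (insert e A) x z \<longrightarrow> x = z"
        using X' y(2) same_face_sym by blast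
      then show ?thesis
        using X(1,2) y \<open>y \<notin> X\<close> P(1,2) P' card insert.hyps
        by (intro exI[of _ "insert y X"] exI[of _ P]) auto
    qed
  qed
qed

section \<open>Borders of faces\<close>

text \<open>An edge with the same face on both sides, that is a bridge, borders no face in this sense.\<close>

definition border :: "complex \<Rightarrow> 'a set set" where
  "border x = {e \<in> E. \<exists>y. y \<notin> drawn E \<and> \<not> same_face E x y \<and> same_face (E - {e}) x y}"

lemma border_sub: "border x \<subseteq> E"
  by (auto simp: border_def)

text \<open>Once \<open>e\<close> is removed, each of the three faces reaches the middle of
  \<open>e\<close>, so all three merge into one face of \<open>E - {e}\<close>. Putting
  \<open>e\<close> back separates only its two sides, and two of the three points are on the same
  side.\<close>

lemma border_at_most_two:
  assumes "e \<in> border x1" "e \<in> border x2" "e \<in> border x3"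
    and x: "x1 \<notin> drawn E" "x2 \<notin> drawn E" "x3 \<notin> drawn E"
  shows "same_face E x1 x2 \<or> same_face E x1 x3 \<or> same_face E x2 x3"
proof -
  have e: "e \<in> E" "E - {e} \<subseteq> E" "e \<notin> E - {e}" and ins: "insert e (E - {e}) = E"
    using assms(1) by (auto simp: border_def)
  obtain u v where uv: "e = {u, v}"
    using e(1) by (rule edge_ends)
  let ?z = "\<gamma> e (1/2)"
  have touch: "linked (E - {e}) u v \<and> same_face (E - {e}) x ?z"
    if "e \<in> border x" "x \<notin> drawn E" for x
  proof -
    obtain y where "y \<notin> drawn E" "\<not> same_face E x y" "same_face (E - {e}) x y"
      using \<open>e \<in> border x\<close> by (auto simp: border_def)
    then show ?thesis
      using same_face_insert_bridge[OF e uv, of x y] separated_face_touches[OF e, of ?z x y] that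
      unfolding ins by auto
  qed
  obtain I J a b where sd: "sides e (E - {e}) I J" and "a \<in> I" "b \<in> J" "a \<notin> drawn E" "b \<notin> drawn E"
      "same_face (E - {e}) a ?z" "same_face (E - {e}) b ?z"
    by (rule edge_sides[OF e uv conjunct1[OF touch[OF assms(1) x(1)]]])
  note same = sides_same[OF sd, unfolded ins]
  have together: "same_face (E - {e}) x y"
    if "e \<in> border x" "e \<in> border y" "x \<notin> drawn E" "y \<notin> drawn E" for x y
    using same_face_trans[OF conjunct2[OF touch[OF that(1,3)]] same_face_sym[OF conjunct2[OF touch[OF that(2,4)]]]] .
  have "x1 \<in> I \<or> x1 \<in> J" "x2 \<in> I \<or> x2 \<in> J" "x3 \<in> I \<or> x3 \<in> J"
    using sides_cover[OF sd] x by blast+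
  then show ?thesis
    using same[OF together[OF assms(1,2) x(1,2)]] same[OF together[OF assms(1,3) x(1,3)]]
      same[OF together[OF assms(2,3) x(2,3)]] by blast
qed

text \<open>
  Deleting edges that do not border the face of \<open>x\<close> does not change it: if a deleted edge \<open>e\<close>
  merged the face with another one, then points close to the middle of \<open>e\<close> on both of its sides
  would witness that \<open>e\<close> borders the face in the full drawing.
\<close>

lemma same_face_border:
  assumes "border x \<subseteq> A" "A \<subseteq> E" "x \<notin> drawn E" "y \<notin> drawn E"
  shows "same_face A x y \<longleftrightarrow> same_face E x y"
proof -
  have "finite (E - A)" using finite_E by blast
  moreover have "\<forall>y. y \<notin> drawn E \<longrightarrow> same_face (E - B) x y \<longleftrightarrow> same_face E x y"
    if "finite B" "B \<subseteq> E - border x" for B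
    using that
  proof (induction B rule: finite_induct)
    case (insert e B)
    define A where "A = E - insert e B"
    have e: "e \<in> E" "A \<subseteq> E" "e \<notin> A" and ins: "insert e A = E - B"
      using insert by (auto simp: A_def)
    have IH: "y \<notin> drawn E \<Longrightarrow> same_face (insert e A) x y \<longleftrightarrow> same_face E x y" for y
      using insert ins by auto
    obtain u v where uv: "e = {u, v}"
      using e(1) by (rule edge_ends)
    let ?z = "\<gamma> e (1/2)"
    have sub: "drawn (insert e A) \<subseteq> drawn E"
      using e by (intro drawn_mono) auto
    have "same_face E x y" if y: "y \<notin> drawn E" and xy: "same_face A x y" for y
    proof (rule ccontr)
      assume no: "\<not> same_face E x y"
      then have no': "\<not> same_face (insert e A) x y" using IH y by blast
      have lk: "linked A u v"
        using same_face_insert_bridge[OF e uv, of x y] xy no' y assms(3) sub by blast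
      have xz: "same_face A x ?z"
        using separated_face_touches[OF e _ xy no', of ?z] by simp
      obtain I J a b where sd: "sides e A I J"
        and ab: "a \<in> I" "b \<in> J" "a \<notin> drawn E" "b \<notin> drawn E"
          "same_face (E - {e}) a ?z" "same_face (E - {e}) b ?z"
        by (rule edge_sides[OF e uv lk])
      note same = sides_same[OF sd] and sep = sides_separate[OF sd]
      have sub': "A \<subseteq> E - {e}" using e by blast
      have az: "same_face A x a" "same_face A x b"
        using same_face_trans[OF xz same_face_sym[OF same_face_antimono[OF ab(5) sub']]]
          same_face_trans[OF xz same_face_sym[OF same_face_antimono[OF ab(6) sub']]] by auto
      have abz: "same_face (E - {e}) a b" "same_face (E - {e}) b a"
        using same_face_trans[OF ab(5) same_face_sym[OF ab(6)]]
          same_face_trans[OF ab(6) same_face_sym[OF ab(5)]] by auto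
      have "e \<in> border x"
      proof (cases "x \<in> I")
        case True
        then have "same_face E x a" using same[OF az(1)] ab IH by blast
        then have "same_face (E - {e}) x b"
          using same_face_trans[OF same_face_antimono[of E x a "E - {e}"] abz(1)] by blast
        moreover have "\<not> same_face E x b" using sep[OF True ab(2)] ab IH by blast
        ultimately show ?thesis unfolding border_def using e ab by blast
      next
        case False
        then have J: "x \<in> J" using sides_cover[OF sd] assms(3) by blast
        then have "same_face E x b" using same[OF az(2)] ab IH by blast
        then have "same_face (E - {e}) x a"
          using same_face_trans[OF same_face_antimono[of E x b "E - {e}"] abz(2)] by blast
        moreover have "\<not> same_face E x a" using sep[OF ab(1) J] ab IH same_face_sym by blast
        ultimately show ?thesis unfolding border_def using e ab by blast
      qed
      then show False using insert.prems by blast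
    qed
    then show ?case
      using same_face_antimono[of E x _ A] e(2) unfolding A_def by blast
  qed simp
  ultimately have "same_face (E - (E - A)) x y \<longleftrightarrow> same_face E x y"
    using assms by blast
  then show ?thesis using assms(2) by (simp add: double_diff)
qed

text \<open>Otherwise \<open>e\<close> is a bridge of \<open>border x\<close>, so inserting it
  separates nothing and \<open>x\<close>, \<open>y\<close> share a face of \<open>border x\<close>.
  That face agrees with the face of \<open>x\<close> in the full drawing, where \<open>e\<close>
  does separate \<open>x\<close> from \<open>y\<close>. Consequently every border edge lies on a
  cycle of border edges.\<close>

lemma border_linked:
  assumes "e \<in> border x" "e = {u, v}" "x \<notin> drawn E"
  shows "linked (border x - {e}) u v"
proof (rule ccontr)
  assume no: "\<not> linked (border x - {e}) u v"
  let ?A = "border x - {e}"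
  have e: "e \<in> E" "?A \<subseteq> E" "e \<notin> ?A" and ins: "insert e ?A = border x"
    using assms(1) by (auto simp: border_def)
  obtain y where y: "y \<notin> drawn E" "\<not> same_face E x y" "same_face (E - {e}) x y"
    using assms(1) by (auto simp: border_def)
  have "same_face ?A x y"
    using y(3) by (rule same_face_antimono) (use border_sub in blast)
  moreover have "drawn (border x) \<subseteq> drawn E" by (simp add: border_sub drawn_mono)
  ultimately have "same_face (border x) x y"
    using same_face_insert_bridge[OF e assms(2) no, of x y] y(1) assms(3) unfolding ins by blast
  then show False
    using y same_face_border[of x "border x" y] border_sub assms(3) by blast
qed

lemma same_face_empty: "x \<notin> drawn {} \<Longrightarrow> y \<notin> drawn {} \<Longrightarrow> same_face {} x y"
proof -
  have "connected (UNIV - p ` V)"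
    using finite_V by (intro connected_open_delete_finite) auto
  then show "x \<notin> drawn {} \<Longrightarrow> y \<notin> drawn {} \<Longrightarrow> same_face {} x y"
    by (simp add: connected_iff_connected_component Compl_eq_Diff_UNIV drawn_def)
qed

text \<open>With an empty border all edges could be deleted without changing the face, but removing
  finitely many points leaves the plane connected.\<close>

lemma border_nonempty:
  assumes "x \<notin> drawn E" "y \<notin> drawn E" "\<not> same_face E x y"
  shows "border x \<noteq> {}"
proof
  assume "border x = {}"
  then have "\<not> same_face {} x y"
    using same_face_border[of x "{}" y] assms by auto
  then show False
    using same_face_empty assms drawn_mono[of "{}" E] by blast
qed

text \<open>The triangle alone has only two faces, and a face of \<open>E\<close> bordered by it
  takes up one of them entirely. Two of the three points lie on the same side, and any two of them
  include \<open>x1\<close> or \<open>x2\<close>.\<close>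

lemma triangle_borders:
  assumes T: "border x1 = {{a, b}, {b, c}, {c, a}}" "border x2 = border x1"
    and abc: "a \<noteq> b" "b \<noteq> c" "c \<noteq> a"
    and x: "x1 \<notin> drawn E" "x2 \<notin> drawn E" "x3 \<notin> drawn E"
  shows "same_face E x1 x2 \<or> same_face E x1 x3 \<or> same_face E x2 x3"
proof -
  let ?A1 = "{{b, c}}" and ?A2 = "{{c, a}, {b, c}}"
  have E: "{a, b} \<in> E" "{b, c} \<in> E" "{c, a} \<in> E"
    using T(1) border_sub[of x1] by auto
  have out: "x \<notin> drawn A" if "x \<notin> drawn E" "A \<subseteq> E" for x A
    using that drawn_mono by blast
  \<comment> \<open>Two sides of the triangle form a path, so they are inserted as bridges and leave
    a single face; only the third side closes a curve.\<close>
  have same2: "same_face ?A2 x y" if xy: "x \<notin> drawn E" "y \<notin> drawn E" for x y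
  proof -
    have "\<not> linked {} b c"
      using abc(2) by (auto elim: rtranclp.cases)
    then have "same_face ?A1 x y"
      using same_face_insert_bridge[of "{b, c}" "{}" b c x y] same_face_empty out xy E by auto
    moreover have "\<not> linked ?A1 a c"
    proof
      assume "linked ?A1 a c"
      then show False using abc
        by (cases rule: converse_rtranclpE) (auto simp: doubleton_eq_iff)
    qed
    ultimately show ?thesis
      using same_face_insert_bridge[of "{c, a}" ?A1 a c x y] out xy E abc
      by (auto simp: doubleton_eq_iff insert_commute)
  qed
  have e: "{a, b} \<in> E" "?A2 \<subseteq> E" "{a, b} \<notin> ?A2" and ins: "insert {a, b} ?A2 = border x1"
    using E abc T by (auto simp: doubleton_eq_iff)
  have "linked ?A2 a c" "linked ?A2 c b"
    by (simp_all add: insert_commute r_into_rtranclp)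
  then have "linked ?A2 a b" by (rule rtranclp_trans)
  then obtain I J d f where sd: "sides {a, b} ?A2 I J" and "d \<in> I" "f \<in> J" "d \<notin> drawn E" "f \<notin> drawn E"
      "same_face (E - {{a, b}}) d (\<gamma> {a, b} (1/2))" "same_face (E - {{a, b}}) f (\<gamma> {a, b} (1/2))"
    by (rule edge_sides[OF e refl])
  note same = sides_same[OF sd, unfolded ins]
  have "same_face (border x1) x y" if "x \<notin> drawn E" "y \<notin> drawn E" "x \<in> I \<and> y \<in> I \<or> x \<in> J \<and> y \<in> J" for x y
    using same same2 that by blast
  then have "same_face E x y" if "x = x1 \<or> x = x2" "y \<notin> drawn E" "x \<in> I \<and> y \<in> I \<or> x \<in> J \<and> y \<in> J" for x y
    using that same_face_border[of x1 "border x1" y] same_face_border[of x2 "border x2" y]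
      T(2) border_sub[of x1] x(1,2) by auto
  moreover have "x1 \<in> I \<or> x1 \<in> J" "x2 \<in> I \<or> x2 \<in> J" "x3 \<in> I \<or> x3 \<in> J"
    using sides_cover[OF sd] x by blast+
  ultimately show ?thesis using x by blast
qed

end

subsection \<open>The number of edges\<close>

text \<open>The shared edge is \<open>{a, b}\<close>, and the closed walk \<open>a b d e\<close> is
  a 4-cycle unless \<open>a = d\<close> or \<open>b = e\<close>. As \<open>c\<close> may coincide
  with \<open>d\<close> or \<open>e\<close>, two triangles with a common edge are excluded as
  well.\<close>

definition no_triangle_on_quad :: "'a set set \<Rightarrow> bool" where
  "no_triangle_on_quad E \<longleftrightarrow> (\<forall>a b c d e. {a, b} \<in> E \<longrightarrow> {b, c} \<in> E \<longrightarrow> {c, a} \<in> E \<longrightarrow>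
     {b, d} \<in> E \<longrightarrow> {d, e} \<in> E \<longrightarrow> {e, a} \<in> E \<longrightarrow> a = d \<or> b = e)"

lemma no_triangle_on_quadD:
  "no_triangle_on_quad E \<Longrightarrow> {a, b} \<in> E \<Longrightarrow> {b, c} \<in> E \<Longrightarrow> {c, a} \<in> E \<Longrightarrow>
     {b, d} \<in> E \<Longrightarrow> {d, e} \<in> E \<Longrightarrow> {e, a} \<in> E \<Longrightarrow> a = d \<or> b = e"
  unfolding no_triangle_on_quad_def by blast

section \<open>Cycles and their edge sets\<close>

lemma cycle_edges_image: "cycle_edges xs = (\<lambda>i. {xs ! i, xs ! (Suc i mod length xs)}) ` {..<length xs}"
  by (auto simp: cycle_edges_def)

lemma cycle_edges_3: "cycle_edges [a, b, c] = {{a, b}, {b, c}, {c, a}}"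
  unfolding cycle_edges_image by (simp add: lessThan_Suc) blast

text \<open>Length at least 3 matters: on two vertices the edge and the closing edge
  coincide.\<close>

lemma card_cycle_edges:
  assumes "distinct xs" "3 \<le> length xs"
  shows "card (cycle_edges xs) = length xs"
proof -
  let ?n = "length xs" and ?f = "\<lambda>i. {xs ! i, xs ! (Suc i mod length xs)}"
  have "inj_on ?f {..<?n}"
  proof (rule inj_onI)
    fix i j assume ij: "i \<in> {..<?n}" "j \<in> {..<?n}" "?f i = ?f j"
    have m: "Suc k mod ?n < ?n" for k
      using assms(2) by (intro mod_less_divisor) auto
    have eq: "xs ! k = xs ! l \<longleftrightarrow> k = l" if "k < ?n" "l < ?n" for k l
      using nth_eq_iff_index_eq[OF assms(1)] that by blast
    have "xs ! i = xs ! j \<or> xs ! i = xs ! (Suc j mod ?n) \<and> xs ! (Suc i mod ?n) = xs ! j"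
      using ij(3) unfolding doubleton_eq_iff by blast
    then have "i = j \<or> i = Suc j mod ?n \<and> Suc i mod ?n = j"
      using ij(1,2) by (simp add: eq m)
    then show "i = j"
      using ij(1,2) assms(2) by (auto simp: mod_Suc split: if_splits)
  qed
  then show ?thesis by (simp add: cycle_edges_image card_image)
qed

lemma linked_distinct_path:
  assumes "linked A u v"
  shows "\<exists>ws. distinct ws \<and> ws \<noteq> [] \<and> hd ws = u \<and> last ws = v \<and> successively (\<lambda>x y. {x, y} \<in> A) ws"
  using assms
proof (induction rule: rtranclp_induct)
  case base
  then show ?case by (intro exI[of _ "[u]"]) auto
next
  case (step y z)
  then obtain ws where ws: "distinct ws" "ws \<noteq> []" "hd ws = u" "last ws = y" "successively (\<lambda>x y. {x, y} \<in> A) ws"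
    by blast
  show ?case
  proof (cases "z \<in> set ws")
    case True
    then obtain xs ys where "ws = xs @ z # ys" by (meson split_list)
    then show ?thesis
      using ws by (intro exI[of _ "xs @ [z]"]) (auto simp: successively_append_iff hd_append split: if_splits)
  next
    case False
    then show ?thesis
      using ws step.hyps by (intro exI[of _ "ws @ [z]"]) (auto simp: successively_append_iff)
  qed
qed

text \<open>A path from \<open>u\<close> to \<open>v\<close> in \<open>A\<close> without repetitions
  is closed up by \<open>{u, v}\<close>; since that edge is missing from \<open>A\<close>, the path
  has a third vertex.\<close>

lemma linked_cycle:
  assumes "linked A u v" "u \<noteq> v" "{u, v} \<notin> A"
  obtains xs where "is_cycle (insert {u, v} A) xs" "{u, v} \<in> cycle_edges xs"
proof -
  obtain ws where ws: "distinct ws" "ws \<noteq> []" "hd ws = u" "last ws = v" "successively (\<lambda>x y. {x, y} \<in> A) ws"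
    using linked_distinct_path[OF assms(1)] by blast
  have "length ws \<noteq> 1"
    using ws assms(2) by (auto simp: length_Suc_conv)
  moreover have "length ws \<noteq> 2"
    using ws assms(3) by (auto simp: numeral_2_eq_2 length_Suc_conv)
  moreover have "length ws \<noteq> 0" using ws by simp
  ultimately have len: "3 \<le> length ws" by linarith
  have last: "{ws ! (length ws - 1), ws ! 0} = {u, v}"
    using ws by (simp add: hd_conv_nth last_conv_nth insert_commute)
  have "{ws ! i, ws ! (Suc i mod length ws)} \<in> insert {u, v} A" if "i < length ws" for i
  proof (cases "Suc i < length ws")
    case True
    then show ?thesis using successively_nth[OF ws(5) True] by simp
  next
    case False
    then have i: "Suc i = length ws" using that by simp
    then have "{ws ! i, ws ! 0} = {u, v}" using last by (metis diff_Suc_1)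
    then show ?thesis using i by simp
  qed
  then have "is_cycle (insert {u, v} A) ws"
    unfolding is_cycle_def cycle_edges_def using ws(1) len by auto
  moreover have "{u, v} \<in> cycle_edges ws"
  proof -
    obtain i where i: "Suc i = length ws" using len by (cases "length ws") auto
    then have "{ws ! i, ws ! (Suc i mod length ws)} = {u, v}" using last by (metis diff_Suc_1 mod_self)
    then show ?thesis unfolding cycle_edges_image using i by (metis (no_types, lifting) image_eqI lessI lessThan_iff)
  qed
  ultimately show thesis using that by blast
qed

lemma is_cycle_mono: "is_cycle A xs \<Longrightarrow> A \<subseteq> B \<Longrightarrow> is_cycle B xs"
  by (auto simp: is_cycle_def)

lemma triangle_at_edge:
  assumes "is_cycle E xs" "length xs = 3" "e \<in> cycle_edges xs"
  obtains a b c where "e = {a, b}" "cycle_edges xs = {{a, b}, {b, c}, {c, a}}" "a \<noteq> b" "b \<noteq> c" "c \<noteq> a"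
proof -
  obtain x y z where xs: "xs = [x, y, z]"
    using assms(2) by (auto simp: numeral_3_eq_3 length_Suc_conv)
  have d: "x \<noteq> y" "y \<noteq> z" "z \<noteq> x"
    using assms(1) xs by (auto simp: is_cycle_def)
  have T: "cycle_edges xs = {{x, y}, {y, z}, {z, x}}"
    unfolding xs by (rule cycle_edges_3)
  then consider "e = {x, y}" | "e = {y, z}" | "e = {z, x}" using assms(3) by auto
  then show thesis
    by cases (use that[of x y z] that[of y z x] that[of z x y] d T in auto)
qed

text \<open>Distinct third vertices \<open>c\<close> and \<open>d\<close> over \<open>{a, b}\<close>
  would give the 4-cycle \<open>a c b d\<close> through an edge of the triangle
  \<open>a b c\<close>.\<close>

lemma triangle_through_edge_unique:
  assumes E: "no_triangle_on_quad E"
    and xs: "is_cycle E xs" "length xs = 3" "e \<in> cycle_edges xs"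
    and ys: "is_cycle E ys" "length ys = 3" "e \<in> cycle_edges ys"
  shows "cycle_edges xs = cycle_edges ys"
proof -
  obtain a b c where abc: "e = {a, b}" "cycle_edges xs = {{a, b}, {b, c}, {c, a}}" "a \<noteq> b" "b \<noteq> c" "c \<noteq> a"
    using xs by (rule triangle_at_edge)
  obtain a' b' d where abd: "e = {a', b'}" "cycle_edges ys = {{a', b'}, {b', d}, {d, a'}}"
    using ys by (rule triangle_at_edge)
  have "cycle_edges ys = {{a, b}, {b, d}, {d, a}}"
    using abc(1) abd by (auto simp: doubleton_eq_iff)
  moreover from this have "c = d"
    using E[unfolded no_triangle_on_quad_def, rule_format, of a c b b d] abc xs(1) ys(1)
    by (auto simp: is_cycle_def insert_commute)
  ultimately show ?thesis using abc by simp
qed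

lemma two_weights_le:
  assumes "3 \<le> (c::nat)" "3 \<le> d" "c = 3 \<longrightarrow> 5 \<le> d" "d = 3 \<longrightarrow> 5 \<le> c"
  shows "1 / real c + 1 / real d \<le> 8 / 15"
proof -
  have le: "1 / real n \<le> 1 / k" if "k \<le> real n" "0 < k" for n :: nat and k
    using that by (intro frac_le) auto
  consider "c = 3" "5 \<le> d" | "d = 3" "5 \<le> c" | "4 \<le> c" "4 \<le> d"
    using assms by linarith
  then show ?thesis
  proof cases
    case 1
    then have "1 / real c = 1 / 3" "1 / real d \<le> 1 / 5" using le[of 5 d] by auto
    then show ?thesis by linarith
  next
    case 2
    then have "1 / real d = 1 / 3" "1 / real c \<le> 1 / 5" using le[of 5 c] by auto
    then show ?thesis by linarith
  next
    case 3
    then have "1 / real c \<le> 1 / 4" "1 / real d \<le> 1 / 4" using le[of 4 c] le[of 4 d] by auto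
    then show ?thesis by linarith
  qed
qed

text \<open>Every sample point spreads a total weight of 1 evenly over the edges bordering its face.
  If there are at least three points, no edge receives more than 8/15, so 15 |X| \<le> 8 |E|, and
  |E| + 1 \<le> |V| + |X| yields the bound.\<close>

lemma edge_bound:
  fixes V :: "'a set" and E :: "'a set set"
  assumes "simple_graph V E" "finite V" "planar V E"
    and cyc: "\<And>xs ys. is_cycle E xs \<Longrightarrow> length xs = 3 \<Longrightarrow> is_cycle E ys \<Longrightarrow> length ys = 4
           \<Longrightarrow> cycle_edges xs \<inter> cycle_edges ys = {}"
    and quad: "no_triangle_on_quad E"
  shows "7 * card E \<le> 15 * card V"
proof -
  obtain p \<gamma> where "plane_drawing V E p \<gamma>"
    using assms(3) by (auto simp: planar_def)
  then interpret plane_graph V E p \<gamma>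
    using assms by unfold_locales
  obtain X and P :: "'a set set" where X: "finite X" "X \<inter> drawn E = {}" and X3: "\<And>x y. x \<in> X \<Longrightarrow> y \<in> X \<Longrightarrow> same_face E x y \<Longrightarrow> x = y"
    and P: "card E + card P + 1 \<le> card V + card X"
    using many_separated_points[OF order_refl] by metis
  have off: "x \<notin> drawn E" if "x \<in> X" for x using X(2) that by blast
  show ?thesis
  proof (cases "card X \<le> 2")
    \<comment> \<open>At most two sample points leave |E| \<le> |V| + 1, which is enough unless
      \<open>V\<close> is empty.\<close>
    case True
    moreover have "E = {}" if "V = {}"
    proof -
      have "e \<notin> E" for e
        using assms(1) that unfolding simple_graph_def by (cases "e = {}") auto
      then show ?thesis by blast
    qed
    moreover have "0 < card V" if "V \<noteq> {}"
      using assms(2) that by (simp add: card_gt_0_iff)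
    ultimately show ?thesis
      using P by (cases "V = {}") auto
  next
    case False
    \<comment> \<open>A third face rules out two faces bordered by the same triangle, which would
      put weight 2/3 on each of its edges.\<close>
    have another: "\<exists>z\<in>X. z \<noteq> x \<and> z \<noteq> y" for x y
    proof (rule ccontr)
      assume "\<not> ?thesis"
      then have "X \<subseteq> {x, y}" by blast
      then have "card X \<le> card {x, y}" using card_mono[of "{x, y}" X] by simp
      also have "\<dots> \<le> 2" by (simp add: card_insert_if)
      finally show False using False by simp
    qed
    have cycle: "\<exists>xs. is_cycle (border x) xs \<and> e \<in> cycle_edges xs" if xe: "x \<in> X" "e \<in> border x" for x e
    proof -
      obtain u v where uv: "e = {u, v}" "u \<noteq> v"
        using xe(2) border_sub edge_ends by (metis subsetD)
      have "linked (border x - {e}) u v"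
        using border_linked[OF xe(2) uv(1) off[OF xe(1)]] .
      then obtain xs where "is_cycle (insert {u, v} (border x - {e})) xs" "{u, v} \<in> cycle_edges xs"
        by (rule linked_cycle) (use uv in auto)
      then show ?thesis
        using xe(2) uv(1) by (metis insert_Diff)
    qed
    have finb: "finite (border x)" for x
      using border_sub finite_E finite_subset by blast
    have len: "3 \<le> length xs \<and> length xs \<le> card (border x) \<and>
        (length xs = card (border x) \<longrightarrow> cycle_edges xs = border x) \<and> is_cycle E xs"
      if "is_cycle (border x) xs" for x xs
    proof -
      have "distinct xs" "3 \<le> length xs" "cycle_edges xs \<subseteq> border x"
        using that by (auto simp: is_cycle_def)
      then show ?thesis
        using card_cycle_edges[of xs] card_mono[OF finb, of "cycle_edges xs" x]
          card_subset_eq[OF finb, of "cycle_edges xs" x] is_cycle_mono[OF that border_sub] by auto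
    qed
    have ne: "border x \<noteq> {}" if "x \<in> X" for x
    proof -
      obtain y where "y \<in> X" "y \<noteq> x" using another by blast
      then show ?thesis using border_nonempty[of x y] off X3 that by blast
    qed
    have ge3: "3 \<le> card (border x)" if "x \<in> X" for x
      using ne[OF that] cycle[OF that] len by (meson all_not_in_conv order_trans)
    have tri: "\<exists>xs. is_cycle E xs \<and> length xs = 3 \<and> cycle_edges xs = border x"
      if xc: "x \<in> X" "card (border x) = 3" for x
    proof -
      obtain xs where "is_cycle (border x) xs"
        using ne[OF xc(1)] cycle[OF xc(1)] by blast
      then show ?thesis using len[of x xs] xc(2) by (intro exI[of _ xs]) auto
    qed
    \<comment> \<open>Four border edges need not be a 4-cycle. If they are, the triangle
      \<open>T\<close> meets it. If not, every cycle among them is a triangle; two triangles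
      covering \<open>e\<close> and an edge missed by the first share an edge by counting, hence
      coincide, a contradiction.\<close>
    have four: False if x: "x \<in> X" "card (border x) = 4" "e \<in> border x"
      and T: "is_cycle E T" "length T = 3" "e \<in> cycle_edges T" for x e T
    proof -
      have no4: "length ys \<noteq> 4" if "is_cycle (border x) ys" for ys
        using len[OF that] cyc[OF T(1,2), of ys] T(3) x(2,3) by auto
      have all3: "length ys = 3" if "is_cycle (border x) ys" for ys
        using len[OF that] no4[OF that] x(2) by linarith
      obtain xs where xs: "is_cycle (border x) xs" "e \<in> cycle_edges xs"
        using cycle[OF x(1,3)] by blast
      have cx: "card (cycle_edges xs) = 3" "cycle_edges xs \<subseteq> border x"
        using xs(1) all3[OF xs(1)] card_cycle_edges[of xs] by (auto simp: is_cycle_def)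
      then obtain f where f: "f \<in> border x" "f \<notin> cycle_edges xs"
      proof -
        have "border x \<noteq> cycle_edges xs" using cx(1) x(2) by auto
        then show thesis using cx(2) that by blast
      qed
      obtain ys where ys: "is_cycle (border x) ys" "f \<in> cycle_edges ys"
        using cycle[OF x(1) f(1)] by blast
      have cy: "card (cycle_edges ys) = 3" "cycle_edges ys \<subseteq> border x"
        using ys(1) all3[OF ys(1)] card_cycle_edges[of ys] by (auto simp: is_cycle_def)
      have "cycle_edges xs \<inter> cycle_edges ys \<noteq> {}"
      proof
        assume "cycle_edges xs \<inter> cycle_edges ys = {}"
        then have "card (cycle_edges xs \<union> cycle_edges ys) = 6"
          using cx cy card_Un_disjoint[of "cycle_edges xs" "cycle_edges ys"] finite_subset[OF _ finb[of x]] by simp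
        moreover have "card (cycle_edges xs \<union> cycle_edges ys) \<le> card (border x)"
          using cx cy finb by (intro card_mono) auto
        ultimately show False using x(2) by simp
      qed
      then obtain g where g: "g \<in> cycle_edges xs" "g \<in> cycle_edges ys" by blast
      have "cycle_edges xs = cycle_edges ys"
        using triangle_through_edge_unique[OF quad _ all3[OF xs(1)] g(1) _ all3[OF ys(1)] g(2)] len xs(1) ys(1)
        by blast
      then show False using f(2) ys(2) by blast
    qed
    have pair: "1 / real (card (border x)) + 1 / real (card (border y)) \<le> 8 / 15"
      if xy: "x \<in> X" "y \<in> X" "x \<noteq> y" "e \<in> border x" "e \<in> border y" for x y e
    proof -
      have 1: "5 \<le> card (border y)" if h: "card (border x) = 3" "x \<in> X" "y \<in> X" "x \<noteq> y" "e \<in> border x" "e \<in> border y" for x y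
      proof (rule ccontr)
        assume "\<not> ?thesis"
        then have c: "card (border y) = 3 \<or> card (border y) = 4"
          using ge3[OF \<open>y \<in> X\<close>] by linarith
        obtain xs where xs: "is_cycle E xs" "length xs = 3" "cycle_edges xs = border x"
          using tri h by blast
        have "card (border y) = 3"
          using c four[OF h(3) _ h(6) xs(1,2)] xs(3) h(5) by blast
        then obtain ys where ys: "is_cycle E ys" "length ys = 3" "cycle_edges ys = border y"
          using tri h by blast
        have eq: "border y = border x"
          using triangle_through_edge_unique[OF quad xs(1,2) _ ys(1,2)] xs(3) ys(3) h by auto
        obtain a b c where "border x = {{a, b}, {b, c}, {c, a}}" "a \<noteq> b" "b \<noteq> c" "c \<noteq> a"
          using triangle_at_edge[OF xs(1,2), of e] xs(3) h(5) by metis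
        moreover obtain z where "z \<in> X" "z \<noteq> x" "z \<noteq> y" using another by blast
        ultimately show False
          using triangle_borders[of x a b c y z] eq off h X3 by metis
      qed
      show ?thesis
        using 1[of x y] 1[of y x] xy ge3 by (intro two_weights_le) auto
    qed
    have edge: "(\<Sum>x\<in>X. if e \<in> border x then 1 / real (card (border x)) else 0) \<le> 8 / 15" for e
    proof -
      define S where "S = {x \<in> X. e \<in> border x}"
      have S: "finite S" "(\<Sum>x\<in>X. if e \<in> border x then 1 / real (card (border x)) else 0)
          = (\<Sum>x\<in>S. 1 / real (card (border x)))"
        using X(1) by (auto simp: S_def sum.inter_filter)
      have "card S \<le> 2"
      proof (rule ccontr)
        assume "\<not> ?thesis"
        then obtain T where "T \<subseteq> S" "card T = 3"
          using obtain_subset_with_card_n[of 3 S] by auto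
        then obtain x1 x2 x3 where "x1 \<in> S" "x2 \<in> S" "x3 \<in> S" "x1 \<noteq> x2" "x1 \<noteq> x3" "x2 \<noteq> x3"
          by (auto simp: card_3_iff)
        then show False
          using border_at_most_two[of e x1 x2 x3] X3 off by (auto simp: S_def)
      qed
      then consider "S = {}" | x where "S = {x}" | x y where "S = {x, y}" "x \<noteq> y"
        using S(1) by (metis card_0_eq card_1_singletonE card_2_iff le_Suc_eq le_zero_eq numeral_2_eq_2 One_nat_def)
      then show ?thesis
      proof cases
        case 1
        then show ?thesis unfolding S(2) by simp
      next
        case (2 x)
        then have "3 \<le> card (border x)" using ge3 by (auto simp: S_def)
        then have "1 / real (card (border x)) \<le> 1 / 3" by (intro frac_le) auto
        then show ?thesis unfolding S(2) 2 by simp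
      next
        case (3 x y)
        then have "x \<in> X" "y \<in> X" "e \<in> border x" "e \<in> border y"
          unfolding S_def by blast+
        then show ?thesis unfolding S(2) 3(1) using pair 3(2) by simp
      qed
    qed
    have "real (card X) = (\<Sum>x\<in>X. \<Sum>e\<in>E. if e \<in> border x then 1 / real (card (border x)) else 0)"
    proof -
      have "(\<Sum>e\<in>E. if e \<in> border x then 1 / real (card (border x)) else 0) = 1" if "x \<in> X" for x
      proof -
        have "(\<Sum>e\<in>E. if e \<in> border x then 1 / real (card (border x)) else 0)
            = (\<Sum>e\<in>{e\<in>E. e \<in> border x}. 1 / real (card (border x)))"
          by (rule sum.inter_filter[OF finite_E, symmetric])
        also have "{e\<in>E. e \<in> border x} = border x" using border_sub by auto
        finally show ?thesis using ge3[OF that] by simp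
      qed
      then show ?thesis by simp
    qed
    also have "\<dots> = (\<Sum>e\<in>E. \<Sum>x\<in>X. if e \<in> border x then 1 / real (card (border x)) else 0)"
      by (rule sum.swap)
    also have "\<dots> \<le> (\<Sum>e\<in>E. 8 / 15)"
      using edge by (intro sum_mono)
    finally have "15 * real (card X) \<le> 8 * real (card E)" by simp
    then have "15 * card X \<le> 8 * card E" by linarith
    then show ?thesis using P by linarith
  qed
qed

subsection \<open>Independent sets in graphs without triangles on 4-cycles\<close>

definition nbrs :: "'a set set \<Rightarrow> 'a \<Rightarrow> 'a set" where
  "nbrs E v = {u. {v, u} \<in> E}"

abbreviation deg :: "'a set set \<Rightarrow> 'a \<Rightarrow> nat" where
  "deg E v \<equiv> card (nbrs E v)"

definition delete :: "'a set set \<Rightarrow> 'a set \<Rightarrow> 'a set set" where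
  "delete E R = {e \<in> E. e \<inter> R = {}}"

definition inside_edges :: "'a set set \<Rightarrow> 'a set \<Rightarrow> 'a set set" where
  "inside_edges E R = {e \<in> E. e \<subseteq> R}"

definition cut_edges :: "'a set set \<Rightarrow> 'a set \<Rightarrow> 'a set set" where
  "cut_edges E R = {e \<in> E. e \<inter> R \<noteq> {} \<and> \<not> e \<subseteq> R}"

definition isolated_triangles :: "'a set set \<Rightarrow> 'a set set" where
  "isolated_triangles E = {T. card T = 3 \<and> (\<forall>x\<in>T. nbrs E x = T - {x})}"

text \<open>
  The weights 53, 125 and 10 balance the tightest step, the deletion of the closed neighbourhood of
  a vertex in a 4-regular graph with two triangles at every vertex: 5 vertices and 14 edges
  disappear, and \<open>5 * 53 = 125 + 14 * 10\<close>. A triangle component then misses the bound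
  by \<open>3 * 53 - 125 - 3 * 10 = 4\<close>.
\<close>

definition large_independent :: "'a set \<Rightarrow> 'a set set \<Rightarrow> bool" where
  "large_independent V E \<longleftrightarrow> (\<exists>S. independent_set V E S \<and>
     53 * card V \<le> 125 * card S + 10 * card E + 4 * card (isolated_triangles E))"

lemma in_nbrs [simp]: "u \<in> nbrs E v \<longleftrightarrow> {v, u} \<in> E"
  by (simp add: nbrs_def)

section \<open>Edges and triangle components around a deleted vertex set\<close>

context fin_graph
begin

lemma nbrs_sub: "nbrs E v \<subseteq> V"
  using edge_in_V by auto

lemma finite_nbrs: "finite (nbrs E v)"
  using nbrs_sub finite_V finite_subset by blast

text \<open>A cut edge has one end in \<open>R\<close> and an inside edge two. Deleting
  \<open>R\<close> therefore destroys as many edges as the degree sum over \<open>R\<close> minus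
  the inside edges, which turns lower bounds on degrees into gains.\<close>

lemma degree_sum:
  assumes "R \<subseteq> V"
  shows "(\<Sum>v\<in>R. deg E v) = card (cut_edges E R) + 2 * card (inside_edges E R)"
proof -
  have fR: "finite R" using assms finite_V finite_subset by blast
  have "deg E v = (\<Sum>e\<in>E. if v \<in> e then 1 else 0)" for v
  proof -
    have "bij_betw (\<lambda>u. {v, u}) (nbrs E v) {e \<in> E. v \<in> e}"
    proof (rule bij_betwI')
      fix e assume "e \<in> {e \<in> E. v \<in> e}"
      then have e: "e \<in> E" "v \<in> e" by auto
      obtain a b where "e = {a, b}" using e(1) by (rule edgeE)
      then have "e = {v, a} \<or> e = {v, b}" using e(2) by auto
      then show "\<exists>u\<in>nbrs E v. e = {v, u}" using e(1) by auto
    qed (auto simp: doubleton_eq_iff)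
    then have "deg E v = card {e \<in> E. v \<in> e}" by (rule bij_betw_same_card)
    also have "\<dots> = (\<Sum>e\<in>E. if v \<in> e then 1 else 0)"
      unfolding card_eq_sum by (rule sum.inter_filter[OF finite_E])
    finally show ?thesis .
  qed
  then have "(\<Sum>v\<in>R. deg E v) = (\<Sum>e\<in>E. \<Sum>v\<in>R. if v \<in> e then 1 else 0)"
    by (simp add: sum.swap[of _ E])
  also have "\<dots> = (\<Sum>e\<in>E. (if e \<in> cut_edges E R then 1 else 0) + 2 * (if e \<in> inside_edges E R then 1 else 0))"
  proof (rule sum.cong[OF refl])
    fix e assume e: "e \<in> E"
    obtain a b where ab: "e = {a, b}" "a \<noteq> b" using e by (rule edgeE)
    have "(\<Sum>v\<in>R. if v \<in> e then 1 else 0) = card (R \<inter> e)"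
      using fR by (simp add: sum.If_cases Int_def)
    also have "\<dots> = (if e \<in> cut_edges E R then 1 else 0) + 2 * (if e \<in> inside_edges E R then 1 else 0)"
      using e ab by (auto simp: cut_edges_def inside_edges_def Int_insert_right)
    finally show "(\<Sum>v\<in>R. if v \<in> e then 1 else 0)
        = (if e \<in> cut_edges E R then 1 else 0) + 2 * (if e \<in> inside_edges E R then 1 else (0::nat))" .
  qed
  also have "\<dots> = card (cut_edges E R) + 2 * card (inside_edges E R)"
  proof -
    have "{e \<in> E. e \<in> cut_edges E R} = cut_edges E R" "{e \<in> E. e \<in> inside_edges E R} = inside_edges E R"
      by (auto simp: cut_edges_def inside_edges_def)
    then show ?thesis
      unfolding sum.distrib sum_distrib_left[symmetric] sum.inter_filter[OF finite_E, symmetric] by simp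
  qed
  finally show ?thesis .
qed

lemma card_E_split: "card E = card (delete E R) + card (cut_edges E R) + card (inside_edges E R)"
proof -
  have "E = delete E R \<union> (cut_edges E R \<union> inside_edges E R)"
    by (auto simp: delete_def cut_edges_def inside_edges_def)
  moreover have "cut_edges E R \<inter> inside_edges E R = {}"
    by (auto simp: cut_edges_def inside_edges_def)
  moreover have "delete E R \<inter> (cut_edges E R \<union> inside_edges E R) = {}"
  proof -
    have "e \<noteq> {}" if "e \<in> E" for e using that by (rule edgeE) simp
    then show ?thesis by (force simp: delete_def cut_edges_def inside_edges_def)
  qed
  moreover have "finite (delete E R)" "finite (cut_edges E R)" "finite (inside_edges E R)"
    using finite_E by (auto simp: delete_def cut_edges_def inside_edges_def)
  ultimately show ?thesis
    using card_Un_disjoint[of "delete E R" "cut_edges E R \<union> inside_edges E R"]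
      card_Un_disjoint[of "cut_edges E R" "inside_edges E R"] by simp
qed

lemma isolated_triangle_vertex:
  assumes "T \<in> isolated_triangles (delete E R)" "x \<in> T"
  shows "x \<notin> R" "nbrs E x = (T - {x}) \<union> (nbrs E x \<inter> R)" "T \<inter> R = {}"
    "deg E x = 2 + card (nbrs E x \<inter> R)"
proof -
  have T: "card T = 3" "\<And>y. y \<in> T \<Longrightarrow> nbrs (delete E R) y = T - {y}"
    using assms(1) by (auto simp: isolated_triangles_def)
  \<comment> \<open>A vertex of \<open>R\<close> has no neighbour left after the deletion, whereas a
    vertex of \<open>T\<close> has two.\<close>
  have out: "y \<notin> R" if "y \<in> T" for y
  proof -
    have "card (T - {y}) = 2" using T(1) that by simp
    then have "nbrs (delete E R) y \<noteq> {}"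
      using T(2)[OF that] by (metis card.empty zero_neq_numeral)
    then show ?thesis by (auto simp: delete_def)
  qed
  show "x \<notin> R" "T \<inter> R = {}" using out assms(2) by auto
  have "nbrs (delete E R) x = nbrs E x - R"
    using out[OF assms(2)] by (auto simp: delete_def)
  then show n: "nbrs E x = (T - {x}) \<union> (nbrs E x \<inter> R)"
    using T(2)[OF assms(2)] by blast
  have "card ((T - {x}) \<union> (nbrs E x \<inter> R)) = card (T - {x}) + card (nbrs E x \<inter> R)"
    using \<open>T \<inter> R = {}\<close> finite_nbrs T(1) by (intro card_Un_disjoint) (auto intro: card_ge_0_finite)
  then show "deg E x = 2 + card (nbrs E x \<inter> R)"
    using n T(1) assms(2) by simp
qed

lemma isolated_triangle_edges:
  assumes "T \<in> isolated_triangles (delete E R)" "x \<in> T" "y \<in> T" "x \<noteq> y"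
  shows "{x, y} \<in> E"
proof -
  have "y \<in> nbrs E x"
    by (subst isolated_triangle_vertex(2)[OF assms(1,2)]) (use assms(3,4) in auto)
  then show ?thesis by simp
qed

lemma finite_isolated_triangles: "finite (isolated_triangles (delete E R))"
proof (rule finite_subset)
  show "isolated_triangles (delete E R) \<subseteq> Pow V"
  proof clarify
    fix T x assume T: "T \<in> isolated_triangles (delete E R)" "x \<in> T"
    then have "card (T - {x}) = 2" by (simp add: isolated_triangles_def)
    then obtain y where "y \<in> T - {x}" by (metis card.empty ex_in_conv zero_neq_numeral)
    then show "x \<in> V" using isolated_triangle_edges[OF T, of y] edge_in_V by auto
  qed
qed (simp add: finite_V)

text \<open>Only these are charged to a deletion; triangle components that were present before are
  already counted for \<open>E\<close>.\<close>

definition new_triangles :: "'a set \<Rightarrow> 'a set set" where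
  "new_triangles R = isolated_triangles (delete E R) - isolated_triangles E"

text \<open>New triangles are disjoint and avoid \<open>R\<close>, so the edges joining them to
  \<open>R\<close> are distinct cut edges; \<open>w\<close> is a guaranteed number of such edges per
  triangle.\<close>

lemma card_new_triangles:
  assumes "R \<subseteq> V" and w: "\<And>T. T \<in> new_triangles R \<Longrightarrow> w \<le> (\<Sum>x\<in>T. card (nbrs E x \<inter> R))"
  shows "w * card (new_triangles R) \<le> card (cut_edges E R)"
proof -
  let ?N = "new_triangles R"
  have N: "T \<in> isolated_triangles (delete E R)" if "T \<in> ?N" for T
    using that by (simp add: new_triangles_def)
  have finT: "finite T" if "T \<in> ?N" for T
    using N[OF that] by (auto simp: isolated_triangles_def intro: card_ge_0_finite)
  have finN: "finite ?N"
    using finite_isolated_triangles by (simp add: new_triangles_def)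
  have disj: "T \<inter> T' = {}" if "T \<in> ?N" "T' \<in> ?N" "T \<noteq> T'" for T T'
  proof (rule ccontr)
    assume "T \<inter> T' \<noteq> {}"
    then obtain x where x: "x \<in> T" "x \<in> T'" by blast
    then have "T - {x} = T' - {x}"
      using N[OF that(1)] N[OF that(2)] by (auto simp: isolated_triangles_def)
    then show False using x that(3) by blast
  qed
  have "w * card ?N = (\<Sum>T\<in>?N. w)" by simp
  also have "\<dots> \<le> (\<Sum>T\<in>?N. \<Sum>x\<in>T. card (nbrs E x \<inter> R))"
    using w by (intro sum_mono)
  also have "\<dots> = (\<Sum>x\<in>\<Union>?N. card (nbrs E x \<inter> R))"
    using finT disj by (simp add: sum.Union_disjoint)
  also have "\<dots> = card (SIGMA x:\<Union>?N. nbrs E x \<inter> R)"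
    using finN finT finite_nbrs by (subst card_SigmaI) auto
  also have "\<dots> \<le> card (cut_edges E R)"
  proof (rule card_inj_on_le)
    have out: "x \<notin> R" if "x \<in> \<Union>?N" for x
      using that N isolated_triangle_vertex(1) by blast
    show "inj_on (\<lambda>(x, y). {x, y}) (SIGMA x:\<Union>?N. nbrs E x \<inter> R)"
      using out by (auto simp: inj_on_def doubleton_eq_iff)
    show "(\<lambda>(x, y). {x, y}) ` (SIGMA x:\<Union>?N. nbrs E x \<inter> R) \<subseteq> cut_edges E R"
      using out by (auto simp: cut_edges_def)
    show "finite (cut_edges E R)" using finite_E by (simp add: cut_edges_def)
  qed
  finally show ?thesis .
qed

text \<open>A triangle component of the remainder with no edge to \<open>R\<close> was a component
  before the deletion.\<close>

lemma card_new_triangles_1: "R \<subseteq> V \<Longrightarrow> card (new_triangles R) \<le> card (cut_edges E R)"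
proof -
  assume R: "R \<subseteq> V"
  have "1 \<le> (\<Sum>x\<in>T. card (nbrs E x \<inter> R))" if "T \<in> new_triangles R" for T
  proof (rule ccontr)
    assume no: "\<not> ?thesis"
    have T: "T \<in> isolated_triangles (delete E R)" "T \<notin> isolated_triangles E"
      using that by (auto simp: new_triangles_def)
    have "finite T" using T(1) by (auto simp: isolated_triangles_def intro: card_ge_0_finite)
    moreover have "(\<Sum>x\<in>T. card (nbrs E x \<inter> R)) = 0" using no by linarith
    ultimately have "nbrs E x \<inter> R = {}" if "x \<in> T" for x
      using that finite_nbrs by (simp add: sum_eq_0_iff)
    then have "nbrs E x = T - {x}" if "x \<in> T" for x
      using isolated_triangle_vertex(2)[OF T(1) that] that by blast
    then show False using T by (simp add: isolated_triangles_def)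
  qed
  then show ?thesis using card_new_triangles[OF R, of 1] by simp
qed

lemma card_new_triangles_mult:
  assumes "R \<subseteq> V" "\<And>T x. T \<in> new_triangles R \<Longrightarrow> x \<in> T \<Longrightarrow> k \<le> card (nbrs E x \<inter> R)"
  shows "3 * k * card (new_triangles R) \<le> card (cut_edges E R)"
proof (rule card_new_triangles[OF assms(1)])
  fix T assume T: "T \<in> new_triangles R"
  then have "3 * k = (\<Sum>x\<in>T. k)" by (simp add: new_triangles_def isolated_triangles_def)
  also have "\<dots> \<le> (\<Sum>x\<in>T. card (nbrs E x \<inter> R))"
    using assms(2)[OF T] by (intro sum_mono)
  finally show "3 * k \<le> (\<Sum>x\<in>T. card (nbrs E x \<inter> R))" .
qed

lemma independent_Un:
  assumes "independent_set V E I" "\<And>v. v \<in> I \<Longrightarrow> nbrs E v \<subseteq> R" "I \<subseteq> R"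
    and "independent_set (V - R) (delete E R) S"
  shows "independent_set V E (I \<union> S)" "I \<inter> S = {}"
proof -
  have S: "S \<subseteq> V - R" "\<And>u v. u \<in> S \<Longrightarrow> v \<in> S \<Longrightarrow> {u, v} \<notin> E"
    using assms(4) by (auto simp: independent_set_def delete_def)
  have I: "I \<subseteq> V" "\<And>u v. u \<in> I \<Longrightarrow> v \<in> I \<Longrightarrow> {u, v} \<notin> E"
    using assms(1) by (auto simp: independent_set_def)
  have "{u, v} \<notin> E" "{v, u} \<notin> E" if "u \<in> I" "v \<in> S" for u v
    using assms(2)[OF that(1)] S(1) that(2) by (auto simp: insert_commute)
  then show "independent_set V E (I \<union> S)" using S I unfolding independent_set_def by blast
  show "I \<inter> S = {}" using S(1) assms(3) by blast
qed

text \<open>All neighbours of \<open>I\<close> are deleted, so \<open>I\<close> can join any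
  independent set of the remainder; \<open>count\<close> is the difference between the bounds wanted
  for \<open>V\<close> and known for \<open>V - R\<close>.\<close>

lemma large_independent_remove:
  assumes I: "independent_set V E I" "\<And>v. v \<in> I \<Longrightarrow> nbrs E v \<subseteq> R" "I \<subseteq> R" and R: "R \<subseteq> V"
    and rest: "large_independent (V - R) (delete E R)"
    and count: "53 * card R + 4 * card (isolated_triangles (delete E R)) \<le> 125 * card I
      + 10 * (card (cut_edges E R) + card (inside_edges E R)) + 4 * card (isolated_triangles E)"
  shows "large_independent V E"
proof -
  obtain S where S: "independent_set (V - R) (delete E R) S"
    "53 * card (V - R) \<le> 125 * card S + 10 * card (delete E R) + 4 * card (isolated_triangles (delete E R))"
    using rest by (auto simp: large_independent_def)
  have IS: "independent_set V E (I \<union> S)" "I \<inter> S = {}"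
    using independent_Un[OF I(1-3) S(1)] by auto
  have fin: "finite R" "finite I" "finite S"
    using finite_subset[OF R finite_V] finite_subset[OF I(3)] finite_subset[OF _ finite_V, of S] S(1)
    by (auto simp: independent_set_def)
  have "card (I \<union> S) = card I + card S"
    using fin IS(2) by (simp add: card_Un_disjoint)
  moreover have "card V = card R + card (V - R)"
    using R fin(1) finite_V card_mono[OF finite_V R] by (simp add: card_Diff_subset)
  ultimately have "53 * card V \<le> 125 * card (I \<union> S) + 10 * card E + 4 * card (isolated_triangles E)"
    using S(2) count card_E_split[of R] by (simp add: algebra_simps)
  then show ?thesis using IS(1) by (auto simp: large_independent_def)
qed

lemma isolated_triangles_delete_le:
  "card (isolated_triangles (delete E R)) \<le> card (isolated_triangles E) + card (new_triangles R)"
proof -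
  have "isolated_triangles (delete E {}) = isolated_triangles E" by (simp add: delete_def)
  then have "finite (isolated_triangles E)" using finite_isolated_triangles[of "{}"] by simp
  then have "card (isolated_triangles (delete E R)) \<le> card (isolated_triangles E \<union> new_triangles R)"
    using finite_isolated_triangles[of R] by (intro card_mono) (auto simp: new_triangles_def)
  then show ?thesis using card_Un_le[of "isolated_triangles E" "new_triangles R"] by linarith
qed

end

text \<open>The assumption \<open>rest\<close> is the induction hypothesis, fixed here so that every
  reduction below can appeal to it.\<close>

locale reducible_graph = fin_graph V E for V :: "'a set" and E :: "'a set set" +
  assumes quad: "no_triangle_on_quad E"
    and rest: "R \<subseteq> V \<Longrightarrow> R \<noteq> {} \<Longrightarrow> large_independent (V - R) (delete E R)"
begin

text \<open>Otherwise the 4-cycle \<open>x z y w\<close> runs through the edge \<open>{x, z}\<close>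
  of the triangle \<open>x y z\<close>.\<close>

lemma diamond_free:
  assumes "{x, y} \<in> E" "{y, z} \<in> E" "{z, x} \<in> E" "{y, w} \<in> E" "{w, x} \<in> E"
  shows "z = w"
  using no_triangle_on_quadD[OF quad, of x z y y w] assms edge_neq by (metis insert_commute)

text \<open>Otherwise \<open>v u x w\<close> is a 4-cycle through the edge \<open>{v, u}\<close> of
  the triangle \<open>v u u'\<close>.\<close>

lemma common_nbr_of_triangle_vertex:
  assumes "u \<in> nbrs E v" "u' \<in> nbrs E v" "{u, u'} \<in> E"
    and "w \<in> nbrs E v" "{x, u} \<in> E" "{x, w} \<in> E" "u \<noteq> w"
  shows "x = v"
  using no_triangle_on_quadD[OF quad, of v u u' x w] assms by (simp add: insert_commute)

text \<open>Each member is the side opposite to \<open>v\<close> in a triangle at \<open>v\<close>,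
  so this set counts the triangles at \<open>v\<close>.\<close>

definition links :: "'a \<Rightarrow> 'a set set" where
  "links v = inside_edges E (nbrs E v)"

lemma finite_links: "finite (links v)"
  using finite_E by (simp add: links_def inside_edges_def)

lemma link_ends:
  assumes "e \<in> links v"
  obtains a b where "e = {a, b}" "{a, b} \<subseteq> nbrs E v" "{a, b} \<in> E"
proof -
  have e: "e \<in> E" "e \<subseteq> nbrs E v" using assms by (auto simp: links_def inside_edges_def)
  obtain a b where "e = {a, b}" using e(1) by (rule edgeE)
  then show thesis using that e by blast
qed

text \<open>Two links with a common end \<open>x\<close> would put \<open>{v, x}\<close> into two
  triangles. So the links form a matching, and a vertex of degree d lies in at most d/2
  triangles.\<close>

lemma links_disjoint:
  assumes "e \<in> links v" "f \<in> links v" "e \<noteq> f"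
  shows "e \<inter> f = {}"
proof (rule ccontr)
  assume "e \<inter> f \<noteq> {}"
  then obtain x where x: "x \<in> e" "x \<in> f" by blast
  have ef: "e \<in> E" "f \<in> E" "e \<subseteq> nbrs E v" "f \<subseteq> nbrs E v"
    using assms by (auto simp: links_def inside_edges_def)
  obtain y where y: "e = {x, y}"
    using edgeE[OF ef(1)] x(1) by (metis insert_commute insertE singletonD)
  obtain z where z: "f = {x, z}"
    using edgeE[OF ef(2)] x(2) by (metis insert_commute insertE singletonD)
  have "y = z"
    using diamond_free[of v x y z] ef y z by (simp add: insert_commute)
  then show False using y z assms(3) by simp
qed

lemma card_Union_links: "card (\<Union>(links v)) = 2 * card (links v)"
proof -
  have two: "card e = 2" if "e \<in> links v" for e
    using that simple by (auto simp: links_def inside_edges_def simple_graph_def)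
  have "card (\<Union>(links v)) = (\<Sum>e\<in>links v. card e)"
    using links_disjoint two
    by (intro card_Union_disjoint) (auto simp: pairwise_def disjnt_def intro: card_ge_0_finite)
  also have "\<dots> = 2 * card (links v)" using two by simp
  finally show ?thesis .
qed

lemma Union_links_sub: "\<Union>(links v) \<subseteq> nbrs E v"
  by (auto simp: links_def inside_edges_def)

lemma card_links_le: "2 * card (links v) \<le> deg E v"
  using card_mono[OF finite_nbrs Union_links_sub, of v] card_Union_links by simp

definition star :: "'a \<Rightarrow> 'a set" where
  "star v = insert v (nbrs E v)"

lemma star_sub: "v \<in> V \<Longrightarrow> star v \<subseteq> V"
  using nbrs_sub by (auto simp: star_def)

lemma card_star: "card (star v) = Suc (deg E v)"
  using finite_nbrs no_loop by (simp add: star_def)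

lemma card_inside_star: "card (inside_edges E (star v)) = deg E v + card (links v)"
proof -
  have "inside_edges E (star v) = (\<lambda>u. {v, u}) ` nbrs E v \<union> links v"
  proof (intro equalityI subsetI)
    fix e assume e: "e \<in> inside_edges E (star v)"
    then have "e \<in> E" "e \<subseteq> insert v (nbrs E v)" by (auto simp: inside_edges_def star_def)
    show "e \<in> (\<lambda>u. {v, u}) ` nbrs E v \<union> links v"
    proof (cases "v \<in> e")
      case True
      obtain a b where "e = {a, b}" using \<open>e \<in> E\<close> by (rule edgeE)
      then have "e = {v, a} \<or> e = {v, b}" using True by auto
      then show ?thesis using \<open>e \<in> E\<close> by auto
    next
      case False
      then show ?thesis using \<open>e \<in> E\<close> \<open>e \<subseteq> insert v (nbrs E v)\<close> by (auto simp: links_def inside_edges_def)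
    qed
  next
    fix e assume "e \<in> (\<lambda>u. {v, u}) ` nbrs E v \<union> links v"
    then show "e \<in> inside_edges E (star v)"
      by (auto simp: links_def inside_edges_def star_def)
  qed
  moreover have "(\<lambda>u. {v, u}) ` nbrs E v \<inter> links v = {}"
    using no_loop by (auto simp: links_def inside_edges_def)
  moreover have "card ((\<lambda>u. {v, u}) ` nbrs E v) = deg E v"
    by (intro card_image) (auto simp: inj_on_def doubleton_eq_iff)
  ultimately show ?thesis
    using finite_nbrs finite_links by (simp add: card_Un_disjoint)
qed

lemma degree_sum_star: "(\<Sum>u\<in>star v. deg E u) = deg E v + (\<Sum>u\<in>nbrs E v. deg E u)"
  using finite_nbrs no_loop by (simp add: star_def)

lemma independent_single: "v \<in> V \<Longrightarrow> independent_set V E {v}"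
  using no_loop by (simp add: independent_set_def)

lemma reduce:
  assumes "independent_set V E I" "\<And>v. v \<in> I \<Longrightarrow> nbrs E v \<subseteq> R" "I \<subseteq> R" "R \<subseteq> V" "R \<noteq> {}"
    and "53 * card R + 4 * card (new_triangles R) \<le> 125 * card I
      + 10 * (card (cut_edges E R) + card (inside_edges E R))"
  shows "large_independent V E"
  using large_independent_remove[OF assms(1-4) rest[OF assms(4,5)]] assms(6)
    isolated_triangles_delete_le[of R] by linarith

text \<open>Deleting the triangle costs 159 and its own edges and \<open>v\<close> return 125 + 30,
  which is short by 4. Each cut edge returns 10 and accounts for at most one new triangle of penalty
  4, so one cut edge suffices. Without cut edges a triangle component disappears, which returns
  exactly 4.\<close>

lemma reduce_triangle_degree_2:
  assumes v: "v \<in> V" "deg E v = 2" "links v \<noteq> {}"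
  shows "large_independent V E"
proof -
  let ?R = "star v"
  have l: "card (links v) = 1"
    using card_links_le[of v] v(2,3) finite_links[of v] card_0_eq[of "links v"] by linarith
  have R: "?R \<subseteq> V" "card ?R = 3" "card (inside_edges E ?R) = 3"
    using v star_sub card_star card_inside_star l by auto
  show ?thesis
  proof (cases "card (cut_edges E ?R) = 0")
    case False
    show ?thesis
    proof (rule reduce[OF independent_single[OF v(1)], of ?R])
      show "53 * card ?R + 4 * card (new_triangles ?R)
          \<le> 125 * card {v} + 10 * (card (cut_edges E ?R) + card (inside_edges E ?R))"
        using card_new_triangles_1[OF R(1)] R False by simp
    qed (use R in \<open>auto simp: star_def\<close>)
  next
    case True
    have cut: "cut_edges E ?R = {}"
      using True finite_E by (simp add: cut_edges_def)
    obtain a b where ab: "{a, b} \<subseteq> nbrs E v" "{a, b} \<in> E"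
      using v(3) link_ends by (metis all_not_in_conv)
    then have "nbrs E v = {a, b}"
      using v(2) finite_nbrs edge_neq[of a b] card_subset_eq[of "nbrs E v" "{a, b}"] by auto
    then have Rab: "?R = {v, a, b}" by (simp add: star_def)
    have closed: "y \<in> ?R" if "{x, y} \<in> E" "x \<in> ?R" for x y
      using that cut by (auto simp: cut_edges_def)
    have d: "v \<noteq> a" "v \<noteq> b" "a \<noteq> b" using ab edge_neq by auto
    have E3: "{v, a} \<in> E" "{v, b} \<in> E" "{a, b} \<in> E" "{a, v} \<in> E" "{b, v} \<in> E" "{b, a} \<in> E"
      using ab by (auto simp: insert_commute)
    have "nbrs E u = ?R - {u}" if "u \<in> ?R" for u
    proof
      show "nbrs E u \<subseteq> ?R - {u}" using closed[of u] that no_loop by auto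
      show "?R - {u} \<subseteq> nbrs E u" using that E3 unfolding Rab by auto
    qed
    then have T: "?R \<in> isolated_triangles E" using R(2) by (simp add: isolated_triangles_def)
    have "new_triangles ?R = {}"
      using card_new_triangles_1[OF R(1)] True finite_isolated_triangles by (simp add: new_triangles_def)
    then have "isolated_triangles (delete E ?R) \<subseteq> isolated_triangles E"
      by (auto simp: new_triangles_def)
    moreover have "?R \<notin> isolated_triangles (delete E ?R)"
      using isolated_triangle_vertex(1)[of ?R ?R v] by (auto simp: star_def)
    ultimately have "isolated_triangles (delete E ?R) \<subseteq> isolated_triangles E - {?R}"
      by blast
    moreover have fin: "finite (isolated_triangles E)"
      using finite_isolated_triangles[of "{}"] by (simp add: delete_def)
    ultimately have "card (isolated_triangles (delete E ?R)) \<le> card (isolated_triangles E - {?R})"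
      by (intro card_mono) auto
    then have "card (isolated_triangles (delete E ?R)) + 1 \<le> card (isolated_triangles E)"
      using T fin card_gt_0_iff[of "isolated_triangles E"] by (auto simp: card_Diff_singleton)
    then show ?thesis
      using large_independent_remove[OF independent_single[OF v(1)], of ?R] R rest[OF R(1)]
      by (auto simp: star_def)
  qed
qed

end

section \<open>Reductions at a vertex of minimum degree other than three\<close>

locale reduced_graph = reducible_graph +
  assumes no_deg2_triangle: "\<And>v. v \<in> V \<Longrightarrow> deg E v = 2 \<Longrightarrow> links v = {}"
begin

text \<open>A vertex of \<open>T\<close> without a neighbour in \<open>R\<close> would have degree 2
  and lie in a triangle, which the locale excludes.\<close>

lemma new_triangle_attached:
  assumes "T \<in> new_triangles R" "x \<in> T"
  shows "1 \<le> card (nbrs E x \<inter> R)"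
proof (rule ccontr)
  assume no: "\<not> ?thesis"
  have T: "T \<in> isolated_triangles (delete E R)" using assms by (simp add: new_triangles_def)
  then have "card (T - {x}) = 2" using assms(2) by (simp add: isolated_triangles_def)
  then obtain y z where yz: "T - {x} = {y, z}" "y \<noteq> z" by (auto simp: card_2_iff)
  then have "{x, y} \<in> E" "{x, z} \<in> E" "{y, z} \<in> E"
    using isolated_triangle_edges[OF T] assms(2) by blast+
  then have "{y, z} \<in> links x" "x \<in> V" using edge_in_V by (auto simp: links_def inside_edges_def)
  moreover have "deg E x = 2"
    using isolated_triangle_vertex(4)[OF T assms(2)] no by linarith
  ultimately show False using no_deg2_triangle by blast
qed

text \<open>
  Every triangle component created by deleting \<open>R\<close> absorbs at least three cut edges, so its
  penalty of 4 is charged to the cut edges; tripling the count keeps it integral.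
\<close>

lemma reduce_weighted:
  assumes "independent_set V E I" "\<And>v. v \<in> I \<Longrightarrow> nbrs E v \<subseteq> R" "I \<subseteq> R" "R \<subseteq> V" "R \<noteq> {}"
    and "159 * card R + 22 * card (inside_edges E R) \<le> 375 * card I + 26 * (\<Sum>v\<in>R. deg E v)"
  shows "large_independent V E"
proof (rule reduce[OF assms(1-5)])
  have "3 * card (new_triangles R) \<le> card (cut_edges E R)"
    using card_new_triangles_mult[OF assms(4), of 1] new_triangle_attached by simp
  \<comment> \<open>With c cut edges and i inside edges, three times the gain less the penalty is 30
    (c + i) - 4 c = 26 (c + 2 i) - 22 i; this is the origin of 26 and 22.\<close>
  moreover have "159 * card R + 22 * card (inside_edges E R)
      \<le> 375 * card I + 26 * (card (cut_edges E R) + 2 * card (inside_edges E R))"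
    using assms(6) unfolding degree_sum[OF assms(4)] .
  ultimately show "53 * card R + 4 * card (new_triangles R) \<le> 125 * card I
      + 10 * (card (cut_edges E R) + card (inside_edges E R))"
    by simp
qed

lemma reduce_star:
  assumes "v \<in> V" "159 * Suc (deg E v) + 22 * (deg E v + card (links v))
    \<le> 375 + 26 * (deg E v + (\<Sum>u\<in>nbrs E v. deg E u))"
  shows "large_independent V E"
proof (rule reduce_weighted[OF independent_single[OF assms(1)], of "star v"])
  show "159 * card (star v) + 22 * card (inside_edges E (star v))
      \<le> 375 * card {v} + 26 * (\<Sum>u\<in>star v. deg E u)"
    using assms(2) unfolding degree_sum_star card_star card_inside_star by simp
qed (use star_sub[OF assms(1)] in \<open>auto simp: star_def\<close>)

lemma reduce_star_exact:
  assumes "v \<in> V" "53 * Suc (deg E v) + 4 * card (new_triangles (star v)) + 10 * (deg E v + card (links v))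
    \<le> 125 + 10 * (deg E v + (\<Sum>u\<in>nbrs E v. deg E u))"
  shows "large_independent V E"
proof (rule reduce[OF independent_single[OF assms(1)], of "star v"])
  show "53 * card (star v) + 4 * card (new_triangles (star v)) \<le> 125 * card {v}
      + 10 * (card (cut_edges E (star v)) + card (inside_edges E (star v)))"
    using assms(2) degree_sum[OF star_sub[OF assms(1)]] unfolding degree_sum_star card_star card_inside_star
    by simp
qed (use star_sub[OF assms(1)] in \<open>auto simp: star_def\<close>)

text \<open>Each vertex of a new triangle has two neighbours in the star, so a new triangle uses six
  cut edges; this is enough if \<open>v\<close> lies in at most one triangle. With two triangles at
  \<open>v\<close> the count can be tight and no new triangle is affordable; but then every
  neighbour of \<open>v\<close> lies in a triangle with \<open>v\<close>, and a vertex attached to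
  two of them would close a 4-cycle on it.\<close>

lemma reduce_min_degree_4:
  assumes v: "v \<in> V" "deg E v = 4" and min: "\<And>u. u \<in> V \<Longrightarrow> 4 \<le> deg E u"
  shows "large_independent V E"
proof -
  have "(\<Sum>u\<in>nbrs E v. 4) \<le> (\<Sum>u\<in>nbrs E v. deg E u)"
    using min by (intro sum_mono) (auto dest: edge_in_V)
  then have D: "16 \<le> (\<Sum>u\<in>nbrs E v. deg E u)" using v(2) by simp
  have t: "card (links v) \<le> 2" using card_links_le[of v] v(2) by simp
  have out: "2 \<le> card (nbrs E x \<inter> star v)" if "T \<in> new_triangles (star v)" "x \<in> T" for T x
  proof -
    have T: "T \<in> isolated_triangles (delete E (star v))" using that by (simp add: new_triangles_def)
    then have "card (T - {x}) = 2" using that(2) by (simp add: isolated_triangles_def)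
    then obtain y where "y \<in> T - {x}" by (metis card.empty ex_in_conv zero_neq_numeral)
    then have "x \<in> V" using isolated_triangle_edges[OF T that(2), of y] edge_in_V by auto
    then show ?thesis using isolated_triangle_vertex(4)[OF T that(2)] min by fastforce
  qed
  have six: "6 * card (new_triangles (star v)) \<le> card (cut_edges E (star v))"
    using card_new_triangles_mult[OF star_sub[OF v(1)], of 2] out by simp
  have cut: "card (cut_edges E (star v)) + 2 * (4 + card (links v)) = 4 + (\<Sum>u\<in>nbrs E v. deg E u)"
    using degree_sum[OF star_sub[OF v(1)]] unfolding degree_sum_star card_inside_star v(2) by simp
  show ?thesis
  proof (cases "card (links v) = 2")
    case False
    then show ?thesis
      using t D six cut by (intro reduce_star_exact[OF v(1)]) (simp add: v(2))
  next
    case True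
    have "\<Union>(links v) = nbrs E v"
      using card_Union_links[of v] True v(2) Union_links_sub finite_nbrs by (intro card_subset_eq) auto
    have "new_triangles (star v) = {}"
    proof (rule ccontr)
      assume "new_triangles (star v) \<noteq> {}"
      then obtain T where T: "T \<in> new_triangles (star v)" by blast
      then have T': "T \<in> isolated_triangles (delete E (star v))" by (simp add: new_triangles_def)
      then obtain x where x: "x \<in> T" by (force simp: isolated_triangles_def)
      have xb: "x \<notin> star v" using isolated_triangle_vertex(1)[OF T' x] .
      have "\<exists>u w. u \<in> nbrs E x \<inter> star v \<and> w \<in> nbrs E x \<inter> star v \<and> u \<noteq> w"
        using out[OF T x] by (metis card_le_Suc0_iff_eq finite_Int finite_nbrs not_less_eq_eq numeral_2_eq_2)
      then obtain u w where uw: "{x, u} \<in> E" "{x, w} \<in> E" "u \<in> star v" "w \<in> star v" "u \<noteq> w" by auto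
      have "u \<noteq> v" "w \<noteq> v" using uw(1,2) xb by (auto simp: star_def insert_commute)
      then have uwv: "u \<in> nbrs E v" "w \<in> nbrs E v" using uw by (auto simp: star_def)
      obtain e where e: "e \<in> links v" "u \<in> e" using \<open>\<Union>(links v) = nbrs E v\<close> uwv(1) by blast
      then have "e \<in> E" "e \<subseteq> nbrs E v" by (auto simp: links_def inside_edges_def)
      moreover obtain a b where ab: "e = {a, b}" using \<open>e \<in> E\<close> by (rule edgeE)
      ultimately have "u = a \<and> b \<in> nbrs E v \<or> u = b \<and> a \<in> nbrs E v" "{a, b} \<in> E" "{b, a} \<in> E"
        using e(2) by (auto simp: insert_commute)
      then obtain u' where "u' \<in> nbrs E v" "{u, u'} \<in> E" by blast
      then have "x = v" using common_nbr_of_triangle_vertex[of u v u' w x] uw uwv by blast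
      then show False using xb by (simp add: star_def)
    qed
    then show ?thesis using D True by (intro reduce_star_exact[OF v(1)]) (simp add: v(2))
  qed
qed

text \<open>The degrees of the neighbours add up to at least d * d, where d is the degree of
  \<open>v\<close>. With that value the weighted inequality fails for d = 3, and for d = 4 with a
  triangle at \<open>v\<close>, hence the separate treatment. From 7 on the weaker bound 7 d keeps
  the arithmetic linear.\<close>

lemma reduce_min_degree_large:
  assumes v: "v \<in> V" "deg E v \<noteq> 3" "deg E v \<noteq> 4" and min: "\<And>u. u \<in> V \<Longrightarrow> deg E v \<le> deg E u"
  shows "large_independent V E"
proof (rule reduce_star[OF v(1)])
  let ?d = "deg E v"
  have "(\<Sum>u\<in>nbrs E v. ?d) \<le> (\<Sum>u\<in>nbrs E v. deg E u)"
    using min by (intro sum_mono) (auto dest: edge_in_V)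
  then have D: "?d * ?d \<le> (\<Sum>u\<in>nbrs E v. deg E u)" by simp
  have t: "2 * card (links v) \<le> ?d" by (rule card_links_le)
  have t2: "card (links v) = 0" if "?d = 2" using no_deg2_triangle[OF v(1) that] by simp
  consider "?d = 0" | "?d = 1" | "?d = 2" | "?d = 5" | "?d = 6" | "7 \<le> ?d"
    using v(2,3) by linarith
  then show "159 * Suc ?d + 22 * (?d + card (links v)) \<le> 375 + 26 * (?d + (\<Sum>u\<in>nbrs E v. deg E u))"
  proof cases
    case 6
    then have "7 * ?d \<le> (\<Sum>u\<in>nbrs E v. deg E u)"
      using D mult_le_mono1[of 7 ?d ?d] by linarith
    then show ?thesis using t by simp
  qed (use D t t2 in auto)
qed

end

lemma no_triangle_on_quad_mono:
  assumes "no_triangle_on_quad E" "F \<subseteq> E"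
  shows "no_triangle_on_quad F"
  unfolding no_triangle_on_quad_def
proof (intro allI impI)
  fix a b c d e
  assume "{a, b} \<in> F" "{b, c} \<in> F" "{c, a} \<in> F" "{b, d} \<in> F" "{d, e} \<in> F" "{e, a} \<in> F"
  then show "a = d \<or> b = e"
    using no_triangle_on_quadD[OF assms(1), of a b c d e] assms(2) by (meson subsetD)
qed

lemma eq_triple_of_card_le:
  assumes "card A \<le> 3" "finite A" "{a, b, c} \<subseteq> A" "a \<noteq> b" "b \<noteq> c" "a \<noteq> c"
  shows "A = {a, b, c}"
proof (rule sym)
  have "card {a, b, c} = 3" using assms(4-6) by simp
  then show "{a, b, c} = A" using card_seteq[OF assms(2,3)] assms(1) by argo
qed

lemma card_Un3_le: "card (A \<union> B \<union> C) \<le> card A + card B + card C"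
  using card_Un_le[of "A \<union> B" C] card_Un_le[of A B] by linarith

section \<open>Minimum degree three\<close>

context reduced_graph
begin

text \<open>With r deleted vertices, c cut edges and degrees at least 3, it suffices that 114 r
  \<le> 1125 + 11 c. This holds for r \<le> 9, and for r = 10 from c = 2 on. For r = 10 and c = 1
  parity helps: 29 / 2 rounds up to 15 inside edges.\<close>

lemma reduce_three_min_degree_3:
  assumes min: "\<And>u. u \<in> V \<Longrightarrow> 3 \<le> deg E u"
    and I: "independent_set V E I" "card I = 3" "\<And>v. v \<in> I \<Longrightarrow> nbrs E v \<subseteq> R" "I \<subseteq> R" "R \<subseteq> V"
    and R: "card R \<le> 9 \<or> card R = 10 \<and> cut_edges E R \<noteq> {}"
  shows "large_independent V E"
proof (rule reduce_weighted[OF I(1,3-5)])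
  show "R \<noteq> {}" using I(2,4) by auto
  have "(\<Sum>v\<in>R. 3) \<le> (\<Sum>v\<in>R. deg E v)"
    using min I(5) by (intro sum_mono) auto
  then have D: "3 * card R \<le> (\<Sum>v\<in>R. deg E v)" by simp
  have cut: "card (cut_edges E R) > 0" if "cut_edges E R \<noteq> {}"
    using that finite_E by (simp add: card_gt_0_iff cut_edges_def)
  have arith: "159 * r + 22 * i \<le> 1125 + 26 * (c + 2 * i)"
    if "3 * r \<le> c + 2 * i" "r \<le> 9 \<or> r = 10 \<and> 0 < c" for r i c :: nat
  proof (cases "r \<le> 9")
    case True
    then show ?thesis using that(1) by simp
  next
    case False
    then have "30 \<le> c + 2 * i" "0 < c" "r = 10" using that by auto
    then have "c = 1 \<and> 15 \<le> i \<or> 2 \<le> c" by linarith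
    then show ?thesis using \<open>30 \<le> c + 2 * i\<close> \<open>r = 10\<close> by auto
  qed
  show "159 * card R + 22 * card (inside_edges E R) \<le> 375 * card I + 26 * (\<Sum>v\<in>R. deg E v)"
    using arith[OF D[unfolded degree_sum[OF I(5)]]] R cut I(2) unfolding degree_sum[OF I(5)] by auto
qed

text \<open>Each vertex of \<open>T\<close> is attached to a neighbour of \<open>v\<close>, and no
  neighbour serves two of them, since that would create a second triangle on an edge of
  \<open>T\<close>. This matches \<open>T\<close> with the neighbourhood. An edge between two
  neighbours would then close a 4-cycle with an edge of \<open>T\<close> and lie in a triangle with
  \<open>v\<close>.\<close>

lemma new_triangle_at_degree_3:
  assumes v: "v \<in> V" "deg E v = 3" and T: "T \<in> new_triangles (star v)"
  obtains p q r x y z where "nbrs E v = {p, q, r}" "T = {x, y, z}" "x \<noteq> y" "y \<noteq> z" "x \<noteq> z"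
    "p \<noteq> q" "q \<noteq> r" "p \<noteq> r" "{p, x} \<in> E" "{q, y} \<in> E" "{r, z} \<in> E" "links v = {}"
proof -
  have T': "T \<in> isolated_triangles (delete E (star v))" using T by (simp add: new_triangles_def)
  have T3: "card T = 3" using T' by (simp add: isolated_triangles_def)
  then obtain x y z where xyz: "T = {x, y, z}" "x \<noteq> y" "y \<noteq> z" "x \<noteq> z" by (auto simp: card_3_iff)
  have disj: "T \<inter> star v = {}" using isolated_triangle_vertex(3)[OF T', of x] xyz by simp
  have E_T: "{a, b} \<in> E" if "a \<in> T" "b \<in> T" "a \<noteq> b" for a b
    using isolated_triangle_edges[OF T' that] .
  have ex: "\<exists>u. u \<in> nbrs E v \<and> {u, a} \<in> E" if a: "a \<in> T" for a
  proof -
    have "nbrs E a \<inter> star v \<noteq> {}" using new_triangle_attached[OF T a] by auto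
    then obtain u where u: "{a, u} \<in> E" "u \<in> star v" by auto
    then have "u \<noteq> v" using disj a by (auto simp: star_def insert_commute)
    then show ?thesis using u by (auto simp: star_def insert_commute)
  qed
  have inj: "a = b" if "a \<in> T" "b \<in> T" "u \<in> nbrs E v" "{u, a} \<in> E" "{u, b} \<in> E" for a b u
  proof (rule ccontr)
    assume "a \<noteq> b"
    have "card (T - {a, b}) = 1" using T3 that(1,2) \<open>a \<noteq> b\<close> by (subst card_Diff_subset) auto
    then obtain c where "T - {a, b} = {c}" by (rule card_1_singletonE)
    then have c: "c \<in> T" "c \<noteq> a" "c \<noteq> b" by auto
    have "c = u"
      using diamond_free[of a b c u] E_T[of a b] E_T[of b c] E_T[of c a] c that \<open>a \<noteq> b\<close>
      by (simp add: insert_commute)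
    then show False using disj c that(3) by (auto simp: star_def)
  qed
  obtain p q r where pqr: "p \<in> nbrs E v" "{p, x} \<in> E" "q \<in> nbrs E v" "{q, y} \<in> E" "r \<in> nbrs E v" "{r, z} \<in> E"
    using ex[of x] ex[of y] ex[of z] xyz(1) by auto
  have ne: "p \<noteq> q" "q \<noteq> r" "p \<noteq> r"
    using inj[of x y p] inj[of y z q] inj[of x z p] pqr xyz by auto
  have N: "nbrs E v = {p, q, r}"
    using v(2) finite_nbrs pqr ne by (intro eq_triple_of_card_le) auto
  have no: "{u, w} \<notin> E" if "u \<in> nbrs E v" "w \<in> nbrs E v" "a \<in> T" "b \<in> T" "a \<noteq> b" "{u, a} \<in> E" "{w, b} \<in> E" for u w a b
  proof
    assume uw: "{u, w} \<in> E"
    have "w = a \<or> u = b"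
      using no_triangle_on_quadD[OF quad, of w u v a b] uw that E_T[of a b] by (simp add: insert_commute)
    then show False using disj that(1-4) by (auto simp: star_def)
  qed
  have "links v = {}"
  proof (rule ccontr)
    assume "links v \<noteq> {}"
    then obtain u w where uw: "{u, w} \<subseteq> nbrs E v" "{u, w} \<in> E" using link_ends by (metis all_not_in_conv)
    have "{p, q} \<notin> E" "{q, r} \<notin> E" "{p, r} \<notin> E"
      using no[of p q x y] no[of q r y z] no[of p r x z] pqr xyz by auto
    moreover have "u \<noteq> w" using uw edge_neq by blast
    ultimately show False using uw N by (auto simp: insert_commute)
  qed
  then show thesis using that[OF N xyz ne pqr(2,4,6)] by blast
qed

text \<open>
  Here the neighbours \<open>p, q, r\<close> of \<open>v\<close> are matched to the new triangle \<open>x, y, z\<close>, and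
  \<open>p\<close>, \<open>q\<close> and \<open>z\<close> together have at most 9 vertices in their closed neighbourhoods.
\<close>

lemma reduce_new_triangle:
  assumes v: "v \<in> V" "deg E v = 3" and T: "T \<in> new_triangles (star v)"
    and min: "\<And>u. u \<in> V \<Longrightarrow> 3 \<le> deg E u" and cubic: "\<And>u. u \<in> nbrs E v \<Longrightarrow> deg E u = 3"
  shows "large_independent V E"
proof -
  obtain p q r x y z where N: "nbrs E v = {p, q, r}" and xyz: "T = {x, y, z}" "x \<noteq> y" "y \<noteq> z" "x \<noteq> z"
    and ne: "p \<noteq> q" "q \<noteq> r" "p \<noteq> r" and E3: "{p, x} \<in> E" "{q, y} \<in> E" "{r, z} \<in> E" and l: "links v = {}"
    using v T by (rule new_triangle_at_degree_3)
  have T': "T \<in> isolated_triangles (delete E (star v))" using T by (simp add: new_triangles_def)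
  have disj: "T \<inter> star v = {}" using isolated_triangle_vertex(3)[OF T', of x] xyz by simp
  have E_T: "{a, b} \<in> E" if "a \<in> T" "b \<in> T" "a \<noteq> b" for a b
    using isolated_triangle_edges[OF T' that] .
  have inS: "v \<in> star v" "p \<in> star v" "q \<in> star v" "r \<in> star v" using N by (auto simp: star_def)
  have out: "a \<noteq> b" if "a \<in> T" "b \<in> star v" for a b using that disj by blast
  have pz: "{p, z} \<notin> E"
  proof
    assume "{p, z} \<in> E"
    then have "y = p"
      using diamond_free[of x z y p] E_T[of x z] E_T[of z y] E_T[of y x] E3 xyz by (simp add: insert_commute)
    then show False using out[of y p] inS xyz by auto
  qed
  have qz: "{q, z} \<notin> E"
  proof
    assume "{q, z} \<in> E"
    then have "x = q"
      using diamond_free[of y z x q] E_T[of y z] E_T[of z x] E_T[of x y] E3 xyz by (simp add: insert_commute)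
    then show False using out[of x q] inS xyz by auto
  qed
  have pq: "{p, q} \<notin> E"
    using l N by (auto simp: links_def inside_edges_def)
  let ?I = "{p, q, z}"
  let ?B = "{p, q, r, z, v, x, y}"
  \<comment> \<open>Since \<open>p\<close> and \<open>q\<close> are cubic, each adds one vertex to
    the seven named ones, and all neighbours of \<open>z\<close> are among those: at most 7 + 1 +
    1.\<close>
  define R where "R = ?B \<union> (nbrs E p - {v, x}) \<union> (nbrs E q - {v, y})"
  have nz: "nbrs E z \<subseteq> {x, y, r}"
  proof -
    have "nbrs E z \<inter> star v \<subseteq> {r}"
    proof
      fix u assume u: "u \<in> nbrs E z \<inter> star v"
      have "z \<notin> nbrs E v" using out[of z z] xyz by (auto simp: star_def)
      then have "u \<noteq> v" using u by (auto simp: insert_commute)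
      then have "u \<in> {p, q, r}" using u N by (auto simp: star_def)
      then show "u \<in> {r}" using u pz qz by (auto simp: insert_commute)
    qed
    then show ?thesis
      using isolated_triangle_vertex(2)[OF T', of z] xyz by auto
  qed
  have vin: "v \<in> nbrs E p" "v \<in> nbrs E q" "x \<in> nbrs E p" "y \<in> nbrs E q" "x \<noteq> v" "y \<noteq> v"
    using N E3 out[of x v] out[of y v] inS xyz by (auto simp: nbrs_def set_eq_iff insert_commute)
  have c1: "card (nbrs E p - {v, x}) = 1" "card (nbrs E q - {v, y}) = 1"
    using cubic[of p] cubic[of q] N vin by (simp_all add: card_Diff_subset)
  show ?thesis
  proof (rule reduce_three_min_degree_3[OF min, of ?I R])
    have "{z, y} \<in> E" using E_T xyz by auto
    then have inV: "p \<in> V" "q \<in> V" "r \<in> V" "x \<in> V" "y \<in> V" "z \<in> V"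
      using E3 edge_in_V by auto
    show "independent_set V E ?I"
      using inV pq pz qz no_loop by (auto simp: independent_set_def insert_commute)
    show "card ?I = 3" using ne out[of z p] out[of z q] inS xyz by auto
    show "nbrs E u \<subseteq> R" if "u \<in> ?I" for u
      using that nz by (auto simp: R_def)
    show "?I \<subseteq> R" by (auto simp: R_def)
    show "R \<subseteq> V" using inV v(1) nbrs_sub by (auto simp: R_def dest: edge_in_V)
    have "card ?B \<le> 7" using card_length[of "[p, q, r, z, v, x, y]"] by simp
    then have "card R \<le> 9"
      unfolding R_def using c1 card_Un3_le[of ?B "nbrs E p - {v, x}" "nbrs E q - {v, y}"] by linarith
    then show "card R \<le> 9 \<or> card R = 10 \<and> cut_edges E R \<noteq> {}" by blast
  qed
qed

lemma triangle_of_cubic_vertex: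
  assumes "card (links v) = 1" "nbrs E v = {a, b, c}" "{a, b} \<notin> E" "{a, c} \<notin> E"
  shows "{b, c} \<in> E"
proof -
  obtain e where "e \<in> links v" using assms(1) by fastforce
  then obtain u w where "{u, w} \<subseteq> nbrs E v" "{u, w} \<in> E" by (rule link_ends)
  then show ?thesis using assms(2-4) edge_neq[of u w] by (auto simp: insert_commute)
qed

lemma link_unique:
  assumes "card (links v) = 1" "{a, b} \<subseteq> nbrs E v" "{a, b} \<in> E" "{c, d} \<subseteq> nbrs E v" "{c, d} \<in> E"
  shows "{a, b} = {c, d}"
proof -
  have "{a, b} \<in> links v" "{c, d} \<in> links v" using assms by (auto simp: links_def inside_edges_def)
  then show ?thesis using assms(1) by (metis card_1_singletonE singletonD)
qed

lemma cubic_nbrs: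
  assumes "deg E v = 3" "a \<in> nbrs E v" "b \<in> nbrs E v" "a \<noteq> b"
  obtains c where "nbrs E v = {a, b, c}" "c \<noteq> a" "c \<noteq> b"
proof -
  have "card (nbrs E v - {a, b}) = 1" using assms by (simp add: card_Diff_subset)
  then obtain c where c: "nbrs E v - {a, b} = {c}" by (rule card_1_singletonE)
  have "nbrs E v = {a, b} \<union> (nbrs E v - {a, b})" using assms(2,3) by blast
  moreover have "{a, b} \<union> {c} = {a, b, c}" by auto
  ultimately have "nbrs E v = {a, b, c}" by (simp only: c)
  moreover have "c \<notin> {a, b}" using c by blast
  ultimately show thesis using that[of c] by simp
qed

text \<open>
  For a triangle \<open>v, x, y\<close> with outer neighbours \<open>z', x', y'\<close> the vertices \<open>x', y', v\<close> are
  selected. Their closed neighbourhoods have at most 10 vertices, and if there are exactly 10 then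
  they do not form a component, because \<open>z'\<close> lies in a triangle of its own.
\<close>

lemma reduce_cubic_triangles:
  assumes v: "v \<in> V" "deg E v = 3" and min: "\<And>u. u \<in> V \<Longrightarrow> 3 \<le> deg E u"
    and all: "\<And>u. u \<in> V \<Longrightarrow> deg E u = 3 \<Longrightarrow> card (links u) = 1 \<and> (\<forall>w\<in>nbrs E u. deg E w = 3)"
  shows "large_independent V E"
proof -
  have one: "card (links u) = 1" if "u \<in> V" "deg E u = 3" for u using all that by blast
  \<comment> \<open>Cubicity spreads along edges, so every vertex met below is cubic and lies in
    exactly one triangle.\<close>
  have step: "w \<in> V \<and> deg E w = 3" if "u \<in> V" "deg E u = 3" "{u, w} \<in> E" for u w
    using all[OF that(1,2)] that(3) edge_in_V[OF that(3)] by simp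
  obtain e where "e \<in> links v" using one[OF v] by fastforce
  then obtain x y where xy: "{x, y} \<subseteq> nbrs E v" "{x, y} \<in> E" by (rule link_ends)
  have "x \<noteq> y" using xy edge_neq by blast
  then obtain z' where Nv: "nbrs E v = {x, y, z'}" and z': "z' \<noteq> x" "z' \<noteq> y"
    using cubic_nbrs[of v x y] v xy by auto
  have vE: "{v, x} \<in> E" "{v, y} \<in> E" "{v, z'} \<in> E" "{x, v} \<in> E" "{y, v} \<in> E" "{z', v} \<in> E" "{y, x} \<in> E"
    using Nv xy by (auto simp: nbrs_def set_eq_iff insert_commute)
  have c: "x \<in> V" "deg E x = 3" "y \<in> V" "deg E y = 3" "z' \<in> V" "deg E z' = 3"
    using step[OF v] vE by auto
  have "v \<noteq> x" "v \<noteq> y" "v \<noteq> z'" using vE edge_neq by blast+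
  obtain x' where Nx: "nbrs E x = {v, y, x'}" and x': "x' \<noteq> v" "x' \<noteq> y"
    using cubic_nbrs[of x v y] c vE xy \<open>v \<noteq> y\<close> by auto
  obtain y' where Ny: "nbrs E y = {v, x, y'}" and y': "y' \<noteq> v" "y' \<noteq> x"
    using cubic_nbrs[of y v x] c vE xy \<open>v \<noteq> x\<close> by auto
  have xE: "{x, x'} \<in> E" "{x', x} \<in> E" "{y, y'} \<in> E" "{y', y} \<in> E"
    using Nx Ny by (auto simp: nbrs_def set_eq_iff insert_commute)
  have c': "x' \<in> V" "deg E x' = 3" "y' \<in> V" "deg E y' = 3"
    using step[OF c(1,2)] step[OF c(3,4)] xE by auto
  have ne: "x' \<noteq> x" "y' \<noteq> y" using xE no_loop by auto
  have nadj: "{v, x'} \<notin> E" "{v, y'} \<notin> E" "{y, x'} \<notin> E" "{x, y'} \<notin> E" "x' \<noteq> y'"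
    using diamond_free[of v x y x'] diamond_free[of v y x y'] diamond_free[of x y v x'] diamond_free[of y x v y']
      vE xE xy x' y' ne by (auto simp: insert_commute)
  \<comment> \<open>Otherwise \<open>y x x' y'\<close> is a 4-cycle through the edge
    \<open>{x, y}\<close> of the triangle at \<open>v\<close>.\<close>
  have xy': "{x', y'} \<notin> E"
    using no_triangle_on_quadD[OF quad, of y x v x' y'] vE xE xy x' y' by (auto simp: insert_commute)
  have z'': "z' \<noteq> x'" "z' \<noteq> y'" using nadj vE by auto
  let ?I = "{x', y', v}"
  let ?B = "{x', y', v, x, y, z'}"
  define R where "R = ?B \<union> (nbrs E x' - {x}) \<union> (nbrs E y' - {y})"
  have c2: "card (nbrs E x' - {x}) = 2" "card (nbrs E y' - {y}) = 2"
    using c' xE by (auto simp: card_Diff_subset)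
  have cB: "card ?B = 6"
    using x' y' ne nadj(5) z' z'' \<open>x \<noteq> y\<close> \<open>v \<noteq> x\<close> \<open>v \<noteq> y\<close> \<open>v \<noteq> z'\<close> by auto
  have le: "card R \<le> 10"
    unfolding R_def using c2 cB card_Un3_le[of ?B "nbrs E x' - {x}" "nbrs E y' - {y}"] by linarith
  have far: False if big: "card R = 10" and no: "cut_edges E R = {}"
  proof -
    \<comment> \<open>If \<open>z'\<close> were adjacent to \<open>x'\<close> or \<open>y'\<close>,
      it would be counted twice among the 6 + 2 + 2 vertices, leaving at most 9.\<close>
    have z_out: "z' \<notin> nbrs E x'" "z' \<notin> nbrs E y'"
    proof -
      show "z' \<notin> nbrs E x'"
      proof
        assume "z' \<in> nbrs E x'"
        then have R': "R = ?B \<union> (nbrs E x' - {x, z'}) \<union> (nbrs E y' - {y})" by (auto simp: R_def)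
        have "card (nbrs E x' - {x, z'}) = 1"
          using c' xE z' \<open>z' \<in> nbrs E x'\<close> by (subst card_Diff_subset) auto
        then have "card R \<le> 9"
          unfolding R' using c2 cB card_Un3_le[of ?B "nbrs E x' - {x, z'}" "nbrs E y' - {y}"] by linarith
        then show False using big by simp
      qed
      show "z' \<notin> nbrs E y'"
      proof
        assume "z' \<in> nbrs E y'"
        then have R': "R = ?B \<union> (nbrs E x' - {x}) \<union> (nbrs E y' - {y, z'})" by (auto simp: R_def)
        have "card (nbrs E y' - {y, z'}) = 1"
          using c' xE z' \<open>z' \<in> nbrs E y'\<close> by (subst card_Diff_subset) auto
        then have "card R \<le> 9"
          unfolding R' using c2 cB card_Un3_le[of ?B "nbrs E x' - {x}" "nbrs E y' - {y, z'}"] by linarith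
        then show False using big by simp
      qed
    qed
    obtain e where "e \<in> links z'" using one[OF c(5,6)] by fastforce
    then obtain s t where st: "{s, t} \<subseteq> nbrs E z'" "{s, t} \<in> E" by (rule link_ends)
    have zs: "{z', s} \<in> E" "{s, z'} \<in> E" using st(1) by (auto simp: insert_commute)
    have z_out': "z' \<notin> nbrs E x" "z' \<notin> nbrs E y"
      unfolding Nx Ny using z' z'' \<open>v \<noteq> z'\<close> by auto
    have "s \<noteq> v"
    proof
      assume "s = v"
      then have "t \<in> nbrs E v" using st(2) by simp
      then have "t \<in> {x, y, z'}" unfolding Nv .
      moreover have "{t, z'} \<in> E" using st(1) by (auto simp: insert_commute)
      ultimately show False using z_out' no_loop by auto
    qed
    have "z' \<in> R" by (auto simp: R_def)
    then have "s \<in> R" using zs no by (auto simp: cut_edges_def)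
    have "s \<noteq> z'" "s \<noteq> x" "s \<noteq> y" "s \<noteq> x'" "s \<noteq> y'"
      using zs no_loop z_out z_out' by auto
    then have or: "s \<in> nbrs E x' - {x} \<or> s \<in> nbrs E y' - {y}"
      using \<open>s \<in> R\<close> \<open>s \<noteq> v\<close> by (auto simp: R_def)
    \<comment> \<open>The triangle at \<open>w\<close> avoids \<open>u\<close>, so it consists of
      \<open>w\<close>, \<open>s\<close> and \<open>s2\<close>. As \<open>s\<close> lies in only one
      triangle, this is also the triangle \<open>z' s t\<close>, which makes \<open>z'\<close> a
      neighbour of \<open>w\<close>.\<close>
    have key: False
      if h: "s \<in> nbrs E w - {u}" "w \<in> V" "deg E w = 3" "{w, u} \<in> E" "z' \<notin> nbrs E w" "z' \<noteq> w"
        "\<And>a. a \<in> nbrs E w \<Longrightarrow> {u, a} \<notin> E" for w u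
    proof -
      obtain s2 where s2: "nbrs E w = {u, s, s2}"
        by (rule cubic_nbrs[OF h(3), of u s]) (use h(1,4) in auto)
      have "{s, s2} \<in> E"
        using triangle_of_cubic_vertex[OF one[OF h(2,3)] s2] h(7)[of s] h(7)[of s2] unfolding s2 by simp
      have "s \<in> nbrs E w" "s2 \<in> nbrs E w" unfolding s2 by simp_all
      then have ws: "{w, s} \<in> E" "{w, s2} \<in> E" by simp_all
      have "s \<in> V" "deg E s = 3" using step[OF h(2,3) ws(1)] by auto
      then have "card (links s) = 1" by (rule one)
      moreover have "{w, s2} \<subseteq> nbrs E s" "{z', t} \<subseteq> nbrs E s" "{z', t} \<in> E"
        using ws \<open>{s, s2} \<in> E\<close> st zs by (auto simp: insert_commute)
      ultimately have "{w, s2} = {z', t}"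
        using link_unique ws(2) by metis
      then have "z' = s2" using h(6) by (auto simp: doubleton_eq_iff)
      then show False using h(5) \<open>s2 \<in> nbrs E w\<close> by simp
    qed
    have xa: "{x, a} \<notin> E" if "a \<in> nbrs E x'" for a
    proof
      assume "{x, a} \<in> E"
      then have "a \<in> {v, y, x'}" unfolding Nx[symmetric] by simp
      then show False using that nadj no_loop by (auto simp: insert_commute)
    qed
    have ya: "{y, a} \<notin> E" if "a \<in> nbrs E y'" for a
    proof
      assume "{y, a} \<in> E"
      then have "a \<in> {v, x, y'}" unfolding Ny[symmetric] by simp
      then show False using that nadj no_loop by (auto simp: insert_commute)
    qed
    from or show False
    proof
      assume "s \<in> nbrs E x' - {x}"
      then show False by (rule key[OF _ c'(1,2) xE(2) z_out(1) z''(1) xa])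
    next
      assume "s \<in> nbrs E y' - {y}"
      then show False by (rule key[OF _ c'(3,4) xE(4) z_out(2) z''(2) ya])
    qed
  qed
  show ?thesis
  proof (rule reduce_three_min_degree_3[OF min, of ?I R])
    show "independent_set V E ?I"
      using c' v(1) nadj xy' no_loop by (auto simp: independent_set_def insert_commute)
    show "card ?I = 3" using x' y' nadj(5) by auto
    show "nbrs E u \<subseteq> R" if "u \<in> ?I" for u
    proof -
      have "nbrs E v \<subseteq> R" unfolding Nv R_def by auto
      moreover have "nbrs E x' \<subseteq> R" "nbrs E y' \<subseteq> R" unfolding R_def by blast+
      ultimately show ?thesis using that by blast
    qed
    show "?I \<subseteq> R" by (auto simp: R_def)
    show "R \<subseteq> V" using c c' v(1) by (auto simp: R_def dest: edge_in_V)
    show "card R \<le> 9 \<or> card R = 10 \<and> cut_edges E R \<noteq> {}" using le far by (cases "card R = 10") auto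
  qed
qed

text \<open>If no star of a cubic vertex were reducible, each such vertex would lie in one triangle
  and have only cubic neighbours: with a triangle the count is 252 against 245 for degree sum 9, but
  255 for degree sum 10. This remaining configuration is then reduced with three selected
  vertices.\<close>

lemma reduce_min_degree_3:
  assumes v: "v \<in> V" "deg E v = 3" and min: "\<And>u. u \<in> V \<Longrightarrow> 3 \<le> deg E u"
  shows "large_independent V E"
proof (rule ccontr)
  assume bad: "\<not> large_independent V E"
  have "card (links u) = 1 \<and> (\<forall>w\<in>nbrs E u. deg E w = 3)" if u: "u \<in> V" "deg E u = 3" for u
  proof -
    let ?D = "\<Sum>w\<in>nbrs E u. deg E w"
    have ge: "3 \<le> deg E w" if "w \<in> nbrs E u" for w using that min edge_in_V by auto
    then have "(\<Sum>w\<in>nbrs E u. 3) \<le> ?D" by (intro sum_mono)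
    then have D: "9 \<le> ?D" using u(2) by simp
    have cubic: "\<forall>w\<in>nbrs E u. deg E w = 3" if "?D = 9"
    proof (rule ccontr)
      assume "\<not> ?thesis"
      then obtain w where w: "w \<in> nbrs E u" "3 < deg E w" using ge by (metis le_neq_implies_less)
      have "(\<Sum>w\<in>nbrs E u. 3) < ?D" using ge w finite_nbrs by (intro sum_strict_mono_ex1) auto
      then show False using that u(2) by simp
    qed
    have t: "card (links u) \<le> 1" using card_links_le[of u] u(2) by linarith
    have no_new: "new_triangles (star u) = {}" if "links u \<noteq> {} \<or> ?D = 9"
    proof (rule ccontr)
      assume "new_triangles (star u) \<noteq> {}"
      then obtain T where T: "T \<in> new_triangles (star u)" by blast
      have "links u = {}" using new_triangle_at_degree_3[OF u T] by metis
      then have "?D = 9" using that by blast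
      then show False using reduce_new_triangle[OF u T min] cubic bad by blast
    qed
    show ?thesis
    proof (cases "card (links u) = 1")
      case True
      then have "links u \<noteq> {}" by auto
      then have "new_triangles (star u) = {}" using no_new by blast
      then have "large_independent V E" if "10 \<le> ?D"
        using that True u(2) by (intro reduce_star_exact[OF u(1)]) simp
      then have "?D = 9" using bad D by linarith
      then show ?thesis using True cubic by blast
    next
      case False
      then have l: "card (links u) = 0" using t by linarith
      have "large_independent V E" if "10 \<le> ?D"
        using that l u(2) by (intro reduce_star[OF u(1)]) simp
      then have "?D < 10" using bad by linarith
      then have "?D = 9" using D by linarith
      \<comment> \<open>The count is 242 against 245, a slack too small for even one new
        triangle.\<close>
      then have "large_independent V E"
        using no_new l u(2) by (intro reduce_star_exact[OF u(1)]) simp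
      then show ?thesis using bad by blast
    qed
  qed
  then show False using reduce_cubic_triangles[OF v min] bad by blast
qed

lemma large_independent_reduced: "large_independent V E"
proof (cases "V = {}")
  case True
  then show ?thesis
    by (auto simp: large_independent_def independent_set_def intro: exI[of _ "{}"])
next
  case False
  then have "Min (deg E ` V) \<in> deg E ` V" using finite_V by (intro Min_in) auto
  then obtain v where v: "v \<in> V" "Min (deg E ` V) = deg E v" by auto
  then have "deg E v \<le> deg E u" if "u \<in> V" for u using finite_V that by (metis Min_le finite_imageI imageI)
  then show ?thesis
    using reduce_min_degree_3[OF v(1)] reduce_min_degree_4[OF v(1)] reduce_min_degree_large[OF v(1)] by metis
qed

end

section \<open>Induction on the number of vertices\<close>

lemma (in reducible_graph) large_independent: "large_independent V E"
proof (cases "\<exists>v\<in>V. deg E v = 2 \<and> links v \<noteq> {}")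
  case True
  then show ?thesis using reduce_triangle_degree_2 by blast
next
  case False
  then interpret reduced_graph V E by unfold_locales auto
  show ?thesis by (rule large_independent_reduced)
qed

lemma large_independent_no_triangle_on_quad:
  assumes "simple_graph V E" "finite V" "no_triangle_on_quad E"
  shows "large_independent V E"
  using assms
proof (induction "card V" arbitrary: V E rule: less_induct)
  case less
  interpret fin_graph V E using less.prems by unfold_locales
  interpret reducible_graph V E
  proof
    show "no_triangle_on_quad E" by fact
    fix R assume R: "R \<subseteq> V" "R \<noteq> {}"
    show "large_independent (V - R) (delete E R)"
    proof (rule less.hyps)
      show "card (V - R) < card V" using R finite_V by (intro psubset_card_mono) auto
      show "simple_graph (V - R) (delete E R)" using simple by (auto simp: simple_graph_def delete_def)
      show "finite (V - R)" using finite_V by simp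
      show "no_triangle_on_quad (delete E R)"
        using less.prems(3) by (rule no_triangle_on_quad_mono) (auto simp: delete_def)
    qed
  qed
  show ?case by (rule large_independent)
qed

subsection \<open>The independence ratio\<close>

lemma cycle_edges_4: "cycle_edges [a, b, c, d] = {{a, b}, {b, c}, {c, d}, {d, a}}"
  unfolding cycle_edges_image by (simp add: lessThan_Suc) blast

lemma no_triangle_on_quadI:
  assumes "simple_graph V E" "finite V"
    and cyc: "\<And>xs ys. is_cycle E xs \<Longrightarrow> length xs = 3 \<Longrightarrow> is_cycle E ys \<Longrightarrow> length ys = 4
           \<Longrightarrow> cycle_edges xs \<inter> cycle_edges ys = {}"
  shows "no_triangle_on_quad E"
  unfolding no_triangle_on_quad_def
proof (intro allI impI, rule ccontr)
  interpret fin_graph V E using assms by unfold_locales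
  fix a b c d e
  assume E: "{a, b} \<in> E" "{b, c} \<in> E" "{c, a} \<in> E" "{b, d} \<in> E" "{d, e} \<in> E" "{e, a} \<in> E"
    and "\<not> (a = d \<or> b = e)"
  then have "distinct [a, b, c]" "distinct [a, b, d, e]"
    using edge_neq[OF E(1)] edge_neq[OF E(2)] edge_neq[OF E(3)] edge_neq[OF E(4)]
      edge_neq[OF E(5)] edge_neq[OF E(6)] by auto
  then have "is_cycle E [a, b, c]" "is_cycle E [a, b, d, e]"
    using E unfolding is_cycle_def cycle_edges_3 cycle_edges_4 by simp_all
  then have "cycle_edges [a, b, c] \<inter> cycle_edges [a, b, d, e] = {}"
    using cyc[of "[a, b, c]" "[a, b, d, e]"] by simp
  then show False
    unfolding cycle_edges_3 cycle_edges_4 by blast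
qed

lemma planar_subgraph:
  assumes "planar V E" "W \<subseteq> V" "F \<subseteq> E"
  shows "planar W F"
proof -
  obtain p \<gamma> where d: "plane_drawing V E p \<gamma>" using assms(1) by (auto simp: planar_def)
  have "inj_on p W"
    using d assms(2) by (auto simp: plane_drawing_def intro: inj_on_subset)
  moreover have "\<gamma> e ` {0<..<1} \<inter> p ` W = {}" if "e \<in> F" for e
  proof -
    have "\<gamma> e ` {0<..<1} \<inter> p ` V = {}"
      using d subsetD[OF assms(3) that] by (simp add: plane_drawing_def)
    moreover have "p ` W \<subseteq> p ` V" using assms(2) by (rule image_mono)
    ultimately show ?thesis by blast
  qed
  ultimately have "plane_drawing W F p \<gamma>"
    using d assms(3) by (simp add: plane_drawing_def subset_iff)
  then show ?thesis by (auto simp: planar_def)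
qed

text \<open>Triangle components are stripped one at a time, each giving one selected vertex for
  three deleted ones, and 90 \<le> 119. Only when none is left are the two bounds combined, with no
  penalty term.\<close>

lemma planar_large_independent:
  assumes "simple_graph V E" "finite V" "planar V E"
    and "\<And>xs ys. is_cycle E xs \<Longrightarrow> length xs = 3 \<Longrightarrow> is_cycle E ys \<Longrightarrow> length ys = 4
           \<Longrightarrow> cycle_edges xs \<inter> cycle_edges ys = {}"
  shows "\<exists>S. independent_set V E S \<and> 30 * card V \<le> 119 * card S"
  using assms
proof (induction "card V" arbitrary: V E rule: less_induct)
  case less
  interpret fin_graph V E using less.prems by unfold_locales
  have del: "delete E {} = E" by (simp add: delete_def)
  show ?case
  proof (cases "isolated_triangles E = {}")
    case True
    have quad: "no_triangle_on_quad E" using less.prems(1,2,4) by (rule no_triangle_on_quadI)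
    obtain S where S: "independent_set V E S" "53 * card V \<le> 125 * card S + 10 * card E"
      using large_independent_no_triangle_on_quad[OF less.prems(1,2) quad] True
      by (auto simp: large_independent_def)
    have "7 * card E \<le> 15 * card V"
      using less.prems quad by (rule edge_bound)
    then show ?thesis using S by (intro exI[of _ S]) linarith
  next
    case False
    then obtain T where T: "T \<in> isolated_triangles (delete E {})" unfolding del by blast
    then have T3: "card T = 3" by (simp add: isolated_triangles_def)
    then obtain x where x: "x \<in> T" by fastforce
    have nT: "nbrs E y \<subseteq> T" if "y \<in> T" for y
      using isolated_triangle_vertex(2)[OF T that] by auto
    have "T \<subseteq> V"
    proof
      fix y assume y: "y \<in> T"
      have "card (T - {y}) = 2" using T3 y by simp
      then obtain z where "z \<in> T - {y}" by (metis card.empty ex_in_conv zero_neq_numeral)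
      then show "y \<in> V" using isolated_triangle_edges[OF T y, of z] edge_in_V by auto
    qed
    have cV: "card V = card (V - T) + 3"
      using card_Diff_subset[of T V] card_mono[OF finite_V \<open>T \<subseteq> V\<close>] finite_subset[OF \<open>T \<subseteq> V\<close> finite_V] \<open>T \<subseteq> V\<close> T3
      by simp
    have sub: "delete E T \<subseteq> E" by (auto simp: delete_def)
    have "\<exists>S. independent_set (V - T) (delete E T) S \<and> 30 * card (V - T) \<le> 119 * card S"
    proof (rule less.hyps)
      show "card (V - T) < card V" using cV by simp
      show "simple_graph (V - T) (delete E T)" using simple by (auto simp: simple_graph_def delete_def)
      show "finite (V - T)" using finite_V by simp
      show "planar (V - T) (delete E T)" using less.prems(3) by (rule planar_subgraph) (use sub in auto)
      show "cycle_edges xs \<inter> cycle_edges ys = {}"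
        if "is_cycle (delete E T) xs" "length xs = 3" "is_cycle (delete E T) ys" "length ys = 4" for xs ys
        using less.prems(4) that is_cycle_mono[OF _ sub] by blast
    qed
    then obtain S where S: "independent_set (V - T) (delete E T) S" "30 * card (V - T) \<le> 119 * card S"
      by blast
    have "independent_set V E {x}"
      using x \<open>T \<subseteq> V\<close> no_loop by (auto simp: independent_set_def)
    then have IS: "independent_set V E ({x} \<union> S)" "{x} \<inter> S = {}"
      using independent_Un[of "{x}" T S] x nT S(1) by auto
    have "finite S" using S(1) finite_V finite_subset[of S V] by (auto simp: independent_set_def)
    then have "card ({x} \<union> S) = Suc (card S)" using IS(2) by simp
    then show ?thesis using IS(1) S(2) cV by (intro exI[of _ "{x} \<union> S"]) simp
  qed
qed

lemma card_le_independence_number: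
  assumes "finite V" "independent_set V E S"
  shows "card S \<le> independence_number V E"
proof -
  have "{card S | S. independent_set V E S} \<subseteq> {..card V}"
    using assms(1) by (auto simp: independent_set_def intro: card_mono)
  then have "finite {card S | S. independent_set V E S}"
    using finite_subset by blast
  then show ?thesis
    unfolding independence_number_def using assms(2) by (intro Max_ge) auto
qed

theorem theorem1p6:
  fixes V :: "'a set" and E :: "'a set set"
  assumes "simple_graph V E" and "finite V" and "V \<noteq> {}"
    and "planar V E"
    and "\<And>xs ys. is_cycle E xs \<Longrightarrow> length xs = 3 \<Longrightarrow> is_cycle E ys \<Longrightarrow> length ys = 4
           \<Longrightarrow> cycle_edges xs \<inter> cycle_edges ys = {}"
  shows "real (card V) / real (independence_number V E) \<le> 4 - 1 / 30"
proof -
  obtain S where S: "independent_set V E S" "30 * card V \<le> 119 * card S"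
    using planar_large_independent[OF assms(1,2,4,5)] by blast
  then have "30 * card V \<le> 119 * independence_number V E"
    using card_le_independence_number[OF assms(2) S(1)] by linarith
  moreover have "0 < card V" using assms(2,3) by (simp add: card_gt_0_iff)
  \<comment> \<open>A positive independence number makes the division meaningful; it follows from
    the bound because \<open>V\<close> is nonempty.\<close>
  ultimately have "0 < independence_number V E" "30 * real (card V) \<le> 119 * real (independence_number V E)"
    by linarith+
  then show ?thesis by (simp add: field_simps)
qed

end
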